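(* Let $G$ be either the abelian group $\mathbb R^n$ or a Heisenberg group $\mathbb H^{2m+1}$ ($m\ge1$, $n=2m+1$). Let $1\le k<n$, and let $q(G,k)$ be the exponent defined by $$q(\mathbb R^n,k)=\frac{n}{n-1},\qquad q(\mathbb H^{2m+1},k)=\frac{2m+2}{2m+1}\ \text{ if }k\ne m+1,\qquad q(\mathbb H^{2m+1},m+1)=\frac{2m+2}{2m}.$$ Then for every $q\in[1,q(G,k)]$ the averaging pairing $$\ell^{q,1}H^k(G)\otimes H^{n-k}(\mathfrak g)\to\mathbb R,\qquad [\omega]\otimes[\beta]\mapsto\int_G\omega\wedge\beta$$ vanishes identically.
   Context: $\mathbb H^{2m+1}$ is the simply connected $(2m+1)$-dimensional Heisenberg group; its Lie algebra has a basis $X_1,\dots,X_m,Y_1,\dots,Y_m,T$ with only nontrivial brackets $[X_i,Y_i]=T$. $\mathfrak g$ denotes the Lie algebra of $G$. **$\ell^{q,p}$ cohomology.** For $1\le p\le q\le\infty$, $\ell^{q,p}H^k(G)$ is the $\ell^{q,p}$ cohomology of any bounded geometry simplicial complex quasi-isometric to $G$. It is computed by differential forms as follows. For an integer $s$ let $\Omega^{k;s,p}$ be the space of $k$-forms on $G$ whose coefficients in a left-invariant frame belong to $L^p$ together with all their left-invariant derivatives up to order $s$. For $s$ large enough (depending only on $G$), $$\ell^{q,p}H^k(G)=\{\omega\in\Omega^{k;s,p}: d\omega=0\}\big/\{\omega\in\Omega^{k;s,p}:\omega=d\phi\text{ for some }\phi\in\Omega^{k-1;s,q}\}.$$ **Lie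 algebra cohomology.** $H^{n-k}(\mathfrak g)$ is the space of closed left-invariant $(n-k)$-forms on $G$ modulo the differentials of left-invariant $(n-k-1)$-forms. **Averaging pairing.** It sends the class of a closed form $\omega\in\Omega^{k;s,1}$ (with $s$ large enough, depending only on $G$) and the class of a closed left-invariant $(n-k)$-form $\beta$ to $\int_G\omega\wedge\beta$; it is well defined for $q\in[1,q(G,k)]$. *)

theory Defs
  imports "HOL-Analysis.Analysis" "HOL-Combinatorics.Permutations"
begin

text \<open>
  A simply connected nilpotent Lie group is given in exponential coordinates: a Euclidean space
  \<^typ>\<open>'a::euclidean_space\<close> with a multiplication \<open>mul\<close> whose unit is \<open>0\<close>. Lebesgue measure in
  these coordinates is a (bi-invariant) Haar measure.

  A \<open>k\<close>-form assigns to each point an alternating \<open>k\<close>-linear form on the tangent space \<open>'a\<close>.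
  A \<open>k\<close>-tuple of tangent vectors is a sequence \<open>v\<close> of which only \<open>v 0, ..., v (k - 1)\<close> matter.
\<close>

type_synonym 'a dform = "'a \<Rightarrow> (nat \<Rightarrow> 'a) \<Rightarrow> real"

definition alternating :: "nat \<Rightarrow> ((nat \<Rightarrow> 'a::real_vector) \<Rightarrow> real) \<Rightarrow> bool" where
  "alternating k \<alpha> \<longleftrightarrow>
     (\<forall>v w. (\<forall>i<k. v i = w i) \<longrightarrow> \<alpha> v = \<alpha> w) \<and>
     (\<forall>v. \<forall>i<k. linear (\<lambda>u. \<alpha> (v(i := u)))) \<and>
     (\<forall>v i j. i < j \<longrightarrow> j < k \<longrightarrow> v i = v j \<longrightarrow> \<alpha> v = 0)"

definition is_form :: "nat \<Rightarrow> 'a::real_vector dform \<Rightarrow> bool" where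
  "is_form k \<omega> \<longleftrightarrow> (\<forall>x. alternating k (\<omega> x))"

definition wedge :: "nat \<Rightarrow> nat \<Rightarrow> 'a dform \<Rightarrow> 'a dform \<Rightarrow> 'a dform" where
  "wedge k l \<omega> \<eta> = (\<lambda>x v.
     (\<Sum>\<sigma> | \<sigma> permutes {..<k + l}.
        of_int (sign \<sigma>) * \<omega> x (\<lambda>i. v (\<sigma> i)) * \<eta> x (\<lambda>i. v (\<sigma> (k + i)))) / (fact k * fact l))"

text \<open>The exterior derivative of a differentiable \<open>k\<close>-form, computed in the global coordinates.\<close>

definition ext_d :: "nat \<Rightarrow> 'a::euclidean_space dform \<Rightarrow> 'a dform" where
  "ext_d k \<omega> = (\<lambda>x v. \<Sum>i\<le>k. (- 1) ^ i *
     frechet_derivative (\<lambda>y. \<omega> y (\<lambda>j. if j < i then v j else v (Suc j))) (at x) (v i))"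

text \<open>The orientation is fixed by an arbitrary enumeration of the coordinate basis; the other
  orientation changes the sign of every integral.\<close>

definition coord_frame :: "nat \<Rightarrow> 'a::euclidean_space" where
  "coord_frame = (SOME e. bij_betw e {..<DIM('a)} Basis)"

definition form_integral :: "'a::euclidean_space dform \<Rightarrow> real" where
  "form_integral \<omega> = (LINT x|lborel. \<omega> x coord_frame)"

primrec Ck :: "nat \<Rightarrow> ('a::euclidean_space \<Rightarrow> real) \<Rightarrow> bool" where
  "Ck 0 f \<longleftrightarrow> continuous_on UNIV f"
| "Ck (Suc k) f \<longleftrightarrow> f differentiable_on UNIV \<and> (\<forall>v. Ck k (\<lambda>x. frechet_derivative f (at x) v))"

definition smooth :: "('a::euclidean_space \<Rightarrow> real) \<Rightarrow> bool" where
  "smooth f \<longleftrightarrow> (\<forall>k. Ck k f)"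

definition test_function :: "('a::euclidean_space \<Rightarrow> real) \<Rightarrow> bool" where
  "test_function \<phi> \<longleftrightarrow> smooth \<phi> \<and> (\<exists>K. compact K \<and> (\<forall>x. x \<notin> K \<longrightarrow> \<phi> x = 0))"

definition test_form :: "nat \<Rightarrow> 'a::euclidean_space dform \<Rightarrow> bool" where
  "test_form l \<psi> \<longleftrightarrow> is_form l \<psi> \<and> (\<forall>v. smooth (\<lambda>x. \<psi> x v)) \<and>
     (\<exists>K. compact K \<and> (\<forall>x v. x \<notin> K \<longrightarrow> \<psi> x v = 0))"

text \<open>\<open>d\<omega> = \<eta>\<close> in the sense of distributions, for a \<open>k\<close>-form \<open>\<omega>\<close> and a \<open>(k + 1)\<close>-form \<open>\<eta>\<close> with
  locally integrable coefficients. The sign comes from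
  \<open>d(\<omega> \<and> \<psi>) = d\<omega> \<and> \<psi> + (-1)^k \<omega> \<and> d\<psi>\<close>. There is no condition when \<open>k\<close> is at least the dimension,
  all forms of degree \<open>k + 1\<close> being zero then.\<close>

definition weak_d :: "nat \<Rightarrow> 'a::euclidean_space dform \<Rightarrow> 'a dform \<Rightarrow> bool" where
  "weak_d k \<omega> \<eta> \<longleftrightarrow> (\<forall>l \<psi>. k + 1 + l = DIM('a) \<longrightarrow> test_form l \<psi> \<longrightarrow>
     form_integral (wedge (k + 1) l \<eta> \<psi>) =
       (- 1) ^ (k + 1) * form_integral (wedge k (l + 1) \<omega> (ext_d l \<psi>)))"

text \<open>The value at \<open>x\<close> of the left-invariant vector field equal to \<open>u\<close> at the unit.\<close>

definition left_field :: "('a::euclidean_space \<Rightarrow> 'a \<Rightarrow> 'a) \<Rightarrow> 'a \<Rightarrow> 'a \<Rightarrow> 'a" where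
  "left_field mul u x = frechet_derivative (mul x) (at 0) u"

definition left_deriv ::
    "('a::euclidean_space \<Rightarrow> 'a \<Rightarrow> 'a) \<Rightarrow> 'a \<Rightarrow> ('a \<Rightarrow> real) \<Rightarrow> 'a \<Rightarrow> real" where
  "left_deriv mul u f x = frechet_derivative f (at x) (left_field mul u x)"

text \<open>Left-invariant vector fields on a unimodular group are divergence-free, so the formal adjoint
  of such a field is its negative.\<close>

definition weak_left_deriv ::
    "('a::euclidean_space \<Rightarrow> 'a \<Rightarrow> 'a) \<Rightarrow> 'a \<Rightarrow> ('a \<Rightarrow> real) \<Rightarrow> ('a \<Rightarrow> real) \<Rightarrow> bool" where
  "weak_left_deriv mul u f g \<longleftrightarrow> (\<forall>\<phi>. test_function \<phi> \<longrightarrow>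
     (LINT x|lborel. g x * \<phi> x) = - (LINT x|lborel. f x * left_deriv mul u \<phi> x))"

definition Lp :: "real \<Rightarrow> ('a::euclidean_space \<Rightarrow> real) \<Rightarrow> bool" where
  "Lp p f \<longleftrightarrow> f \<in> borel_measurable lborel \<and> integrable lborel (\<lambda>x. \<bar>f x\<bar> powr p)"

primrec sobolev ::
    "('a::euclidean_space \<Rightarrow> 'a \<Rightarrow> 'a) \<Rightarrow> nat \<Rightarrow> real \<Rightarrow> ('a \<Rightarrow> real) \<Rightarrow> bool" where
  "sobolev mul 0 p f \<longleftrightarrow> Lp p f"
| "sobolev mul (Suc s) p f \<longleftrightarrow>
     Lp p f \<and> (\<forall>u\<in>Basis. \<exists>g. weak_left_deriv mul u f g \<and> sobolev mul s p g)"

text \<open>The space \<open>\<Omega>\<^sup>k\<^sup>;\<^sup>s\<^sup>,\<^sup>p\<close>; forms that agree almost everywhere are identified only in the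
  cohomology below.\<close>

definition Omega ::
    "('a::euclidean_space \<Rightarrow> 'a \<Rightarrow> 'a) \<Rightarrow> nat \<Rightarrow> nat \<Rightarrow> real \<Rightarrow> 'a dform set" where
  "Omega mul k s p = {\<omega>. is_form k \<omega> \<and>
     (\<forall>b. (\<forall>i<k. b i \<in> Basis) \<longrightarrow> sobolev mul s p (\<lambda>x. \<omega> x (\<lambda>i. left_field mul (b i) x)))}"

definition lqp_cocycles ::
    "('a::euclidean_space \<Rightarrow> 'a \<Rightarrow> 'a) \<Rightarrow> nat \<Rightarrow> real \<Rightarrow> nat \<Rightarrow> 'a dform set" where
  "lqp_cocycles mul s p k = {\<omega> \<in> Omega mul k s p. weak_d k \<omega> (\<lambda>x v. 0)}"

definition lqp_coboundaries ::
    "('a::euclidean_space \<Rightarrow> 'a \<Rightarrow> 'a) \<Rightarrow> nat \<Rightarrow> real \<Rightarrow> real \<Rightarrow> nat \<Rightarrow> 'a dform set" where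
  "lqp_coboundaries mul s q p k =
     {\<omega> \<in> Omega mul k s p. k \<ge> 1 \<and> (\<exists>\<phi> \<in> Omega mul (k - 1) s q. weak_d (k - 1) \<phi> \<omega>)}"

text \<open>Quotient of a space of forms by a subspace, as a set of cosets.\<close>

definition form_quotient :: "'a dform set \<Rightarrow> 'a dform set \<Rightarrow> 'a dform set set" where
  "form_quotient Z B = Z // {(\<omega>, \<omega>'). \<omega> \<in> Z \<and> \<omega>' \<in> Z \<and> (\<lambda>x v. \<omega> x v - \<omega>' x v) \<in> B}"

definition lqp_cohomology ::
    "('a::euclidean_space \<Rightarrow> 'a \<Rightarrow> 'a) \<Rightarrow> nat \<Rightarrow> real \<Rightarrow> real \<Rightarrow> nat \<Rightarrow> 'a dform set set" where
  "lqp_cohomology mul s q p k =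
     form_quotient (lqp_cocycles mul s p k) (lqp_coboundaries mul s q p k)"

definition left_invariant_forms ::
    "('a::euclidean_space \<Rightarrow> 'a \<Rightarrow> 'a) \<Rightarrow> nat \<Rightarrow> 'a dform set" where
  "left_invariant_forms mul j = {\<beta>. is_form j \<beta> \<and>
     (\<forall>g x v. \<beta> (mul g x) (\<lambda>i. frechet_derivative (mul g) (at x) (v i)) = \<beta> x v)}"

definition lie_cohomology ::
    "('a::euclidean_space \<Rightarrow> 'a \<Rightarrow> 'a) \<Rightarrow> nat \<Rightarrow> 'a dform set set" where
  "lie_cohomology mul j = form_quotient
     {\<beta> \<in> left_invariant_forms mul j. ext_d j \<beta> = (\<lambda>x v. 0)}
     {\<beta>. j \<ge> 1 \<and> (\<exists>\<gamma> \<in> left_invariant_forms mul (j - 1). \<beta> = ext_d (j - 1) \<gamma>)}"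

text \<open>The common value of the integrals over all pairs of representatives of the two classes;
  \<open>k\<close> is the degree of the first one.\<close>

definition averaging_pairing ::
    "nat \<Rightarrow> 'a::euclidean_space dform set \<Rightarrow> 'a dform set \<Rightarrow> real" where
  "averaging_pairing k c b =
     (THE r. \<forall>\<omega>\<in>c. \<forall>\<beta>\<in>b. form_integral (wedge k (DIM('a) - k) \<omega> \<beta>) = r)"

definition abelian_mul :: "real ^ 'n \<Rightarrow> real ^ 'n \<Rightarrow> real ^ 'n" where
  "abelian_mul g h = g + h"

definition abelian_exponent :: "nat \<Rightarrow> nat \<Rightarrow> real" where
  "abelian_exponent n k = real n / (real n - 1)"

text \<open>The Heisenberg group in exponential coordinates \<open>(x, y, t)\<close>, where \<open>m = CARD('m)\<close>.\<close>

type_synonym 'm heis = "(real ^ 'm) \<times> (real ^ 'm) \<times> real"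

definition heis_mul :: "'m::finite heis \<Rightarrow> 'm heis \<Rightarrow> 'm heis" where
  "heis_mul = (\<lambda>(x, y, t) (x', y', t'). (x + x', y + y', t + t' + (x \<bullet> y' - y \<bullet> x') / 2))"

definition heis_exponent :: "nat \<Rightarrow> nat \<Rightarrow> real" where
  "heis_exponent m k =
     (if k = m + 1 then (2 * real m + 2) / (2 * real m) else (2 * real m + 2) / (2 * real m + 1))"

lemma heis_mul_group:
  "heis_mul (heis_mul g h) k = heis_mul g (heis_mul h k)"
  "heis_mul 0 g = g" "heis_mul g 0 = g"
  "heis_mul (- g) g = 0" "heis_mul g (- g) = 0"
  by (auto simp: heis_mul_def zero_prod_def inner_add_left inner_add_right inner_commute
      field_simps split: prod.splits)

lemma left_field_abelian: "left_field abelian_mul u x = u"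
proof -
  have "(abelian_mul x has_derivative (\<lambda>h. h)) (at 0)"
    unfolding abelian_mul_def by (auto intro!: derivative_eq_intros)
  from frechet_derivative_at[OF this, symmetric] show ?thesis
    by (simp add: left_field_def)
qed

lemma left_field_heis:
  "left_field heis_mul (a, b, c) (x, y, t) = (a, b, c + (x \<bullet> b - y \<bullet> a) / 2)"
proof -
  have "(heis_mul (x, y, t) has_derivative
      (\<lambda>h. (fst h, fst (snd h), snd (snd h) + (x \<bullet> fst (snd h) - y \<bullet> fst h) / 2))) (at 0)"
    unfolding heis_mul_def case_prod_beta
    by (auto intro!: derivative_eq_intros simp: fun_eq_iff field_simps)
  from frechet_derivative_at[OF this, symmetric] show ?thesis
    by (simp add: left_field_def)
qed

text \<open>The brackets of left-invariant vector fields are those of the Heisenberg Lie algebra: with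
  \<open>X\<^sub>i = (axis i 1, 0, 0)\<close>, \<open>Y\<^sub>i = (0, axis i 1, 0)\<close>, \<open>T = (0, 0, 1)\<close>, the only nontrivial ones are
  \<open>[X\<^sub>i, Y\<^sub>i] = T\<close>.\<close>

definition field_bracket ::
    "('a::euclidean_space \<Rightarrow> 'a) \<Rightarrow> ('a \<Rightarrow> 'a) \<Rightarrow> 'a \<Rightarrow> 'a" where
  "field_bracket V W x =
     frechet_derivative W (at x) (V x) - frechet_derivative V (at x) (W x)"

lemma field_bracket_heis:
  "field_bracket (left_field heis_mul (a, b, c)) (left_field heis_mul (a', b', c')) =
     left_field heis_mul (0, 0, a \<bullet> b' - b \<bullet> a')"
proof -
  have lf: "left_field heis_mul (a, b, c) =
      (\<lambda>g. (a, b, c + (fst g \<bullet> b - fst (snd g) \<bullet> a) / 2))" for a b :: "real ^ 'm" and c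
    by (auto simp: fun_eq_iff left_field_heis)
  have d: "(left_field heis_mul (a, b, c) has_derivative
      (\<lambda>h. (0, 0, (fst h \<bullet> b - fst (snd h) \<bullet> a) / 2))) (at g)" for a b :: "real ^ 'm" and c g
    unfolding lf
    by (auto intro!: derivative_eq_intros simp: fun_eq_iff field_simps)
  have fd: "frechet_derivative (left_field heis_mul (a, b, c)) (at g) h =
      (0, 0, (fst h \<bullet> b - fst (snd h) \<bullet> a) / 2)" for a b :: "real ^ 'm" and c g h
    by (simp add: frechet_derivative_at[OF d, symmetric])
  show ?thesis
    unfolding field_bracket_def fun_eq_iff fd
    by (auto simp: left_field_heis inner_commute field_simps)
qed

end

theory Submission imports Defs begin

text \<open>
  The integral of \<open>\<omega> \<and> \<beta>\<close> vanishes for every closed integrable \<open>k\<close>-form \<open>\<omega>\<close> and every closed left-invariant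
  form \<open>\<beta>\<close> of degree \<open>j = n - k \<ge> 1\<close>, hence so does the pairing of the classes. Since \<open>\<omega>\<close> is closed, it
  integrates to zero against \<open>d \<psi>\<close> for every compactly supported smooth form \<open>\<psi>\<close>. It suffices to find
  such forms \<open>\<psi>\<^sub>r\<close> for which the coefficients of \<open>d \<psi>\<^sub>r\<close> in a left-invariant frame are bounded uniformly in \<open>r\<close>
  and converge pointwise to those of a suitable closed left-invariant form: dominated convergence,
  with the coefficients of \<open>\<omega>\<close> as integrable factors (\<open>tendsto_form_integral_wedge\<close>), then shows that
  the integral against the limit vanishes.

  The forms \<open>\<psi>\<^sub>r = \<iota>\<^sub>Z \<beta>\<close> are contractions with vector fields \<open>Z = Z\<^sub>r\<close>, so that \<open>d \<psi>\<^sub>r\<close> is the Lie derivative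
  \<open>L\<^sub>Z \<beta>\<close> by Cartan's formula (\<open>cartan_formula\<close>, \<open>ext_d_contraction_frame\<close>). On the abelian group \<open>Z\<close> is the
  radial field cut off at distance \<open>r\<close>. On the Heisenberg group the analogue of the radial field is the
  generator of the dilations \<open>(x, y, t) \<mapsto> (r x, r y, r\<^sup>2 t)\<close>, but cutting it off by multiplication produces
  a derivative of size \<open>r\<close>: the \<open>T\<close>-component of the field grows like \<open>r\<^sup>2\<close> and horizontal derivatives of
  the cutoff function decay like \<open>1 / r\<close> only. Instead the cutoff is applied to the contact potential
  \<open>2 t\<close> of this generator. The flow of the resulting compactly supported field preserves the horizontal
  distribution, which removes exactly the unbounded term (\<open>cutoff_field_bracket_eq\<close>). The field \<open>Z\<^sub>r\<close> is
  the image of one fixed contact field under the dilation of ratio \<open>r\<close>, so the bounds come from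
  compactness and the limit depends on the first derivative at the unit only.

  Up to a constant factor the limit is the derivative of \<open>\<beta>\<close> under dilation, that is, \<open>j \<beta>\<^sub>0 + (j + 1) \<beta>\<^sub>1\<close> if \<open>\<beta> = \<beta>\<^sub>0 + \<beta>\<^sub>1\<close> with \<open>\<beta>\<^sub>0\<close>
  horizontal and \<open>\<beta>\<^sub>1\<close> containing the central covector. The automorphism \<open>(x, y, t) \<mapsto> (- x, - y, t)\<close>
  acts on the two parts by opposite signs. Combining the results for \<open>\<beta>\<close> and for its image under this
  automorphism yields the claim (\<open>euler_relation\<close>, \<open>form_integral_wedge_eq_0\<close>).
\<close>

section \<open>Smooth functions with compact support\<close>

lemma Ck_SucI:
  assumes "\<And>x. (f has_derivative f' x) (at x)" and "\<And>v. Ck k (\<lambda>x. f' x v)"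
  shows "Ck (Suc k) f"
proof -
  have "frechet_derivative f (at x) = f' x" for x
    using frechet_derivative_at[OF assms(1)] by simp
  then show ?thesis
    using assms by (auto simp: differentiable_on_def differentiable_def)
qed

lemma Ck_Suc_has_derivative:
  "Ck (Suc k) f \<Longrightarrow> (f has_derivative frechet_derivative f (at x)) (at x)"
  by (simp add: differentiable_on_def frechet_derivative_works)

lemma Ck_Suc_imp_Ck: "Ck (Suc k) f \<Longrightarrow> Ck k f"
proof (induction k arbitrary: f)
  case 0
  then show ?case by (simp add: differentiable_imp_continuous_on)
next
  case (Suc k)
  then show ?case by (metis Ck.simps(2))
qed

lemma Ck_const: "Ck k (\<lambda>x. a)"
proof (induction k arbitrary: a)
  case (Suc k)
  show ?case by (rule Ck_SucI[where f' = "\<lambda>_ _. 0"]) (use Suc in auto)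
qed simp

lemma Ck_add: "Ck k f \<Longrightarrow> Ck k g \<Longrightarrow> Ck k (\<lambda>x. f x + g x)"
proof (induction k arbitrary: f g)
  case 0
  then show ?case by (simp add: continuous_on_add)
next
  case (Suc k)
  show ?case
    by (rule Ck_SucI[OF has_derivative_add[OF Ck_Suc_has_derivative Ck_Suc_has_derivative]])
      (use Suc in auto)
qed

lemma Ck_mult: "Ck k f \<Longrightarrow> Ck k g \<Longrightarrow> Ck k (\<lambda>x. f x * g x)"
proof (induction k arbitrary: f g)
  case 0
  then show ?case by (simp add: continuous_on_mult)
next
  case (Suc k)
  have "Ck k f" "Ck k g"
    using Suc.prems by (blast dest: Ck_Suc_imp_Ck)+
  then show ?case
    by (intro Ck_SucI[OF has_derivative_mult[OF Ck_Suc_has_derivative Ck_Suc_has_derivative]]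
        Ck_add) (use Suc in auto)
qed

lemma Ck_sum: "(\<And>i. i \<in> I \<Longrightarrow> Ck k (f i)) \<Longrightarrow> Ck k (\<lambda>x. \<Sum>i\<in>I. f i x)"
  by (induction I rule: infinite_finite_induct) (auto intro: Ck_const Ck_add)

lemma Ck_linear:
  assumes "linear f" shows "Ck k f"
proof (cases k)
  case 0
  then show ?thesis using assms by (simp add: linear_continuous_on linear_conv_bounded_linear)
next
  case (Suc k')
  then show ?thesis
    using Ck_SucI[of f "\<lambda>_. f" k'] assms Ck_const
    by (auto simp: linear_conv_bounded_linear bounded_linear_imp_has_derivative)
qed

lemma Ck_comp_linear:
  fixes M :: "'a::euclidean_space \<Rightarrow> 'b::euclidean_space"
  assumes "linear M" shows "Ck k f \<Longrightarrow> Ck k (\<lambda>x. f (M x))"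
proof (induction k arbitrary: f)
  case 0
  have "continuous_on UNIV M"
    using assms by (simp add: linear_continuous_on linear_conv_bounded_linear)
  with 0 show ?case
    by (auto intro: continuous_on_compose2)
next
  case (Suc k)
  have M: "(M has_derivative M) (at x)" for x
    using assms by (simp add: linear_conv_bounded_linear bounded_linear_imp_has_derivative)
  show ?case
    by (rule Ck_SucI[OF has_derivative_compose[OF M Ck_Suc_has_derivative]])
      (use Suc in auto)
qed

lemma smooth_const: "smooth (\<lambda>x. a)"
  and smooth_add: "smooth f \<Longrightarrow> smooth g \<Longrightarrow> smooth (\<lambda>x. f x + g x)"
  and smooth_mult: "smooth f \<Longrightarrow> smooth g \<Longrightarrow> smooth (\<lambda>x. f x * g x)"
  and smooth_sum: "(\<And>i. i \<in> I \<Longrightarrow> smooth (h i)) \<Longrightarrow> smooth (\<lambda>x. \<Sum>i\<in>I. h i x)"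
  and smooth_linear: "linear f \<Longrightarrow> smooth f"
  by (auto simp: smooth_def intro: Ck_const Ck_add Ck_mult Ck_sum Ck_linear)

lemma smooth_minus: "smooth f \<Longrightarrow> smooth (\<lambda>x. - f x)"
  using smooth_mult[OF smooth_const[of "-1"]] by simp

lemma smooth_diff: "smooth f \<Longrightarrow> smooth g \<Longrightarrow> smooth (\<lambda>x. f x - g x)"
  using smooth_add[OF _ smooth_minus] by fastforce

lemma smooth_power: "smooth f \<Longrightarrow> smooth (\<lambda>x. f x ^ n)"
  by (induction n) (auto intro: smooth_const smooth_mult)

lemma smooth_comp_linear:
  fixes M :: "'a::euclidean_space \<Rightarrow> 'b::euclidean_space"
  shows "linear M \<Longrightarrow> smooth f \<Longrightarrow> smooth (\<lambda>x. f (M x))"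
  by (auto simp: smooth_def intro: Ck_comp_linear)

lemma smooth_has_derivative:
  "smooth f \<Longrightarrow> (f has_derivative frechet_derivative f (at x)) (at x)"
  using Ck_Suc_has_derivative[of 0 f x] by (simp add: smooth_def del: Ck.simps)

lemma smooth_directional_continuous:
  "smooth f \<Longrightarrow> continuous_on UNIV (\<lambda>x. frechet_derivative f (at x) v)"
  unfolding smooth_def using Ck.simps by metis

text \<open>
  The classical flat function \<open>e\<^sup>-\<^sup>1\<^sup>/\<^sup>s\<close>, divided by all powers of \<open>s\<close>: the derivatives of each member
  are combinations of other members, so that the smoothness of all of them is one induction.
\<close>

definition flat :: "nat \<Rightarrow> real \<Rightarrow> real" where
  "flat n s = (if s > 0 then exp (- 1 / s) / s ^ n else 0)"

lemma flat_has_real_derivative: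
  "(flat n has_real_derivative flat (n + 2) s - n * flat (n + 1) s) (at s)"
proof (cases s "0 :: real" rule: linorder_cases)
  case less
  have "((\<lambda>s. 0) has_real_derivative 0) (at s)" by simp
  then have "(flat n has_real_derivative 0) (at s)"
    by (rule has_field_derivative_transform_within_open[of _ _ _ "{..<0}"])
      (use less in \<open>auto simp: flat_def\<close>)
  then show ?thesis using less by (simp add: flat_def)
next
  case greater
  have "((\<lambda>s. exp (- 1 / s) / s ^ n) has_real_derivative
      flat (n + 2) s - n * flat (n + 1) s) (at s)"
    using greater
    by (auto intro!: derivative_eq_intros simp: flat_def)
      (cases n; auto simp: field_simps power2_eq_square)
  then show ?thesis
    by (rule has_field_derivative_transform_within_open[of _ _ _ "{0<..}"])
      (use greater in \<open>auto simp: flat_def\<close>)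
next
  case equal
  have "((\<lambda>y. inverse y ^ (n + 1) / exp (inverse y)) \<longlongrightarrow> 0) (at_right (0::real))"
    using filterlim_compose[OF tendsto_power_div_exp_0 filterlim_inverse_at_top_right] .
  then have right: "((\<lambda>y. exp (- 1 / y) / y ^ n / y) \<longlongrightarrow> 0) (at_right (0::real))"
    by (simp add: divide_inverse exp_minus power_inverse algebra_simps)
  have "((\<lambda>y. flat n y / y) \<longlongrightarrow> 0) (at_right 0)"
    by (rule Lim_transform_eventually[OF right])
      (auto simp: flat_def eventually_at_filter)
  moreover have "((\<lambda>y. flat n y / y) \<longlongrightarrow> 0) (at_left 0)"
    by (rule Lim_transform_eventually[of "\<lambda>_. 0"])
      (auto simp: flat_def eventually_at_filter)
  ultimately have "((\<lambda>y. flat n y / y) \<longlongrightarrow> 0) (at 0)"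
    by (simp add: filterlim_split_at)
  then show ?thesis
    using equal by (simp add: has_field_derivative_iff flat_def)
qed

text \<open>
  \<open>bump 0\<close> is the cutoff function; the other indices are needed because the derivatives of \<open>bump 0\<close>
  are polynomial combinations of them.
\<close>

definition bump :: "nat \<Rightarrow> 'a::euclidean_space \<Rightarrow> real" where
  "bump n x = flat n (1 - x \<bullet> x)"

lemma bump_has_derivative:
  "(bump n has_derivative
     (\<lambda>v. (bump (n + 2) x - n * bump (n + 1) x) * (- 2 * (x \<bullet> v)))) (at x)"
proof -
  have "((\<lambda>x. 1 - x \<bullet> x) has_derivative (\<lambda>v. - 2 * (x \<bullet> v))) (at x)"
    by (auto intro!: derivative_eq_intros simp: inner_commute)
  from has_derivative_compose[OF this flat_has_real_derivative[unfolded has_field_derivative_def]]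
  show ?thesis by (simp add: bump_def[abs_def])
qed

lemma smooth_bump: "smooth (bump n :: 'a::euclidean_space \<Rightarrow> real)"
proof -
  have "Ck k (bump n :: 'a \<Rightarrow> real)" for k n
  proof (induction k arbitrary: n)
    case 0
    show ?case
      by (simp add: continuous_on_eq_continuous_within has_derivative_continuous[OF bump_has_derivative])
  next
    case (Suc k)
    have lin: "Ck k (\<lambda>x. - 2 * (x \<bullet> v))" for v :: 'a
      by (rule Ck_linear) (auto intro!: linearI simp: algebra_simps inner_add_left)
    have "Ck k (\<lambda>x. (bump (n + 2) x + - real n * bump (n + 1) x) * (- 2 * (x \<bullet> v)))" for v :: 'a
      by (intro Ck_mult Ck_add Ck_const Suc lin)
    then show ?case
      by (intro Ck_SucI[OF bump_has_derivative]) simp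
  qed
  then show ?thesis by (simp add: smooth_def)
qed

lemma bump_eq_0: "x \<notin> cball 0 1 \<Longrightarrow> bump n x = 0"
  by (auto simp: bump_def flat_def dot_square_norm not_le abs_square_less_1 power_mono
      dest: power_strict_mono[of 1 "norm x" 2])

lemma bump_0: "bump n 0 = exp (- 1)"
  by (simp add: bump_def flat_def)

section \<open>Alternating forms\<close>

lemma alternating_cong: "alternating k \<alpha> \<Longrightarrow> (\<And>i. i < k \<Longrightarrow> v i = w i) \<Longrightarrow> \<alpha> v = \<alpha> w"
  by (simp add: alternating_def)

lemma alternating_linear: "alternating k \<alpha> \<Longrightarrow> i < k \<Longrightarrow> linear (\<lambda>u. \<alpha> (v(i := u)))"
  by (simp add: alternating_def)

lemma alternating_slot_add:
  "alternating k \<alpha> \<Longrightarrow> i < k \<Longrightarrow> \<alpha> (v(i := a + b)) = \<alpha> (v(i := a)) + \<alpha> (v(i := b))"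
  using linear_add[OF alternating_linear] by blast

lemma alternating_slot_scale:
  "alternating k \<alpha> \<Longrightarrow> i < k \<Longrightarrow> \<alpha> (v(i := c *\<^sub>R a)) = c * \<alpha> (v(i := a))"
  using linear_scale[OF alternating_linear] by fastforce

lemma alternating_repeat:
  "alternating k \<alpha> \<Longrightarrow> i < k \<Longrightarrow> j < k \<Longrightarrow> i \<noteq> j \<Longrightarrow> v i = v j \<Longrightarrow> \<alpha> v = 0"
  unfolding alternating_def by (metis linorder_neqE_nat)

lemma alternating_swap:
  assumes "alternating k \<alpha>" "i < k" "j < k" "i \<noteq> j"
  shows "\<alpha> (v(i := a, j := b)) = - \<alpha> (v(i := b, j := a))"
proof -
  have lin: "\<alpha> (v(i := x + y, j := z)) = \<alpha> (v(i := x, j := z)) + \<alpha> (v(i := y, j := z))"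
    "\<alpha> (v(i := z, j := x + y)) = \<alpha> (v(i := z, j := x)) + \<alpha> (v(i := z, j := y))" for x y z
    using alternating_slot_add[OF assms(1,2), of "v(j := z)" x y]
      alternating_slot_add[OF assms(1,3), of "v(i := z)" x y] assms(4)
    by (simp_all add: fun_upd_twist)
  have rep: "\<alpha> (v(i := x, j := x)) = 0" for x
    using assms by (intro alternating_repeat[of k \<alpha> i j]) auto
  have "\<alpha> (v(i := a + b, j := a + b)) = 0" by (rule rep)
  then show ?thesis unfolding lin by (simp add: rep)
qed

text \<open>
  Each added multiple of \<open>T\<close> contributes a term in which \<open>T\<close> occurs twice.
\<close>

lemma alternating_absorb:
  assumes "alternating k \<alpha>" "m < k" "v m = T"
  shows "\<alpha> (\<lambda>i. if i = m then T else v i + c i *\<^sub>R T) = \<alpha> v"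
proof -
  \<comment> \<open>The slots are changed one after the other; \<open>w p\<close> is the stage before slot \<open>p\<close>.\<close>
  define w where "w p = (\<lambda>i. if i < p \<and> i \<noteq> m then v i + c i *\<^sub>R T else v i)" for p
  have "\<alpha> (w p) = \<alpha> v" if "p \<le> k" for p
    using that
  proof (induction p)
    case 0
    then show ?case by (simp add: w_def)
  next
    case (Suc p)
    show ?case
    proof (cases "p = m")
      case True
      then have "w (Suc p) = w p" by (auto simp: w_def less_Suc_eq)
      with Suc show ?thesis by simp
    next
      case False
      have upd: "w (Suc p) = (w p)(p := v p + c p *\<^sub>R T)"
        using False by (auto simp: w_def)
      have "\<alpha> ((w p)(p := T)) = 0"
        using assms Suc.prems False by (intro alternating_repeat[of k \<alpha> m p]) (auto simp: w_def)
      moreover have "(w p)(p := v p) = w p" by (auto simp: w_def)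
      moreover have "p < k" using Suc.prems by simp
      ultimately have "\<alpha> (w (Suc p)) = \<alpha> (w p)"
        unfolding upd by (simp add: alternating_slot_add[OF assms(1)]
            alternating_slot_scale[OF assms(1)] del: fun_upd_apply)
      with Suc show ?thesis by simp
    qed
  qed
  from this[of k] show ?thesis
    using assms by (subst alternating_cong[OF assms(1), of _ "w k"]) (auto simp: w_def)
qed

text \<open>
  The multilinear expansion stops at first order, because all terms in which \<open>T\<close> fills two slots
  vanish. This expansion computes left-invariant forms in coordinates, compares the coordinate frame
  with the left-invariant one and describes the reflection below.
\<close>

lemma alternating_add_multiples:
  assumes "alternating k \<alpha>"
  shows "\<alpha> (\<lambda>i. v i + c i *\<^sub>R T) = \<alpha> v + (\<Sum>i<k. c i * \<alpha> (v(i := T)))"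
proof -
  define w where "w p = (\<lambda>i. if i < p then v i + c i *\<^sub>R T else v i)" for p
  have "\<alpha> (w p) = \<alpha> v + (\<Sum>i<p. c i * \<alpha> (v(i := T)))" if "p \<le> k" for p
    using that
  proof (induction p)
    case 0
    then show ?case by (simp add: w_def)
  next
    case (Suc p)
    have upd: "w (Suc p) = (w p)(p := v p + c p *\<^sub>R T)"
      by (auto simp: w_def)
    have "\<alpha> ((w p)(p := T)) = \<alpha> (v(p := T))"
    proof -
      have "\<alpha> ((w p)(p := T))
          = \<alpha> (\<lambda>i. if i = p then T else (v(p := T)) i + (if i < p then c i else 0) *\<^sub>R T)"
        by (rule arg_cong[of _ _ \<alpha>]) (auto simp: w_def)
      also have "\<dots> = \<alpha> (v(p := T))"
        using assms Suc.prems by (intro alternating_absorb) auto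
      finally show ?thesis .
    qed
    moreover have "(w p)(p := v p) = w p" by (auto simp: w_def)
    moreover have "p < k" using Suc.prems by simp
    ultimately have "\<alpha> (w (Suc p)) = \<alpha> (w p) + c p * \<alpha> (v(p := T))"
      unfolding upd by (simp only: alternating_slot_add[OF assms(1)]
          alternating_slot_scale[OF assms(1)])
    with Suc show ?case by (simp del: fun_upd_apply)
  qed
  from this[of k] show ?thesis
    by (subst alternating_cong[OF assms(1), of _ "w k"]) (auto simp: w_def)
qed

lemma alternating_scale:
  assumes "alternating k \<alpha>"
  shows "\<alpha> (\<lambda>i. a *\<^sub>R v i) = a ^ k * \<alpha> v"
proof -
  define w where "w p = (\<lambda>i. if i < p then a *\<^sub>R v i else v i)" for p
  have "\<alpha> (w p) = a ^ p * \<alpha> v" if "p \<le> k" for p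
    using that
  proof (induction p)
    case 0
    then show ?case by (simp add: w_def)
  next
    case (Suc p)
    have upd: "w (Suc p) = (w p)(p := a *\<^sub>R v p)"
      by (auto simp: w_def)
    have "(w p)(p := v p) = w p" by (auto simp: w_def)
    moreover have "p < k" using Suc.prems by simp
    ultimately have "\<alpha> (w (Suc p)) = a * \<alpha> (w p)"
      unfolding upd by (simp only: alternating_slot_scale[OF assms(1)])
    with Suc show ?case by simp
  qed
  from this[of k] show ?thesis
    by (subst alternating_cong[OF assms(1), of _ "w k"]) (auto simp: w_def)
qed

lemma alternating_comp_linear:
  fixes M :: "'b::real_vector \<Rightarrow> 'a::real_vector"
  assumes "alternating k \<alpha>" "linear M"
  shows "alternating k (\<lambda>v. \<alpha> (\<lambda>i. M (v i)))"
  unfolding alternating_def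
proof (intro conjI allI impI)
  fix v :: "nat \<Rightarrow> 'b" and i assume "i < k"
  have "(\<lambda>j. M ((v(i := u)) j)) = (\<lambda>j. M (v j))(i := M u)" for u
    by auto
  then show "linear (\<lambda>u. \<alpha> (\<lambda>j. M ((v(i := u)) j)))"
    using linear_compose[OF assms(2) alternating_linear[OF assms(1) \<open>i < k\<close>]]
    by (simp add: o_def)
next
  fix v :: "nat \<Rightarrow> 'b" and i j assume "i < j" "j < k" "v i = v j"
  then show "\<alpha> (\<lambda>i. M (v i)) = 0"
    by (intro alternating_repeat[OF assms(1), of i j]) auto
qed (auto intro!: alternating_cong[OF assms(1)])

lemma alternating_linear_combination:
  assumes "alternating k \<alpha>" "alternating k \<beta>"
  shows "alternating k (\<lambda>v. a * \<alpha> v + b * \<beta> v)"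
  unfolding alternating_def
proof (intro conjI allI impI)
  fix v w :: "nat \<Rightarrow> 'a" assume "\<forall>i<k. v i = w i"
  then have "\<alpha> v = \<alpha> w" "\<beta> v = \<beta> w"
    using alternating_cong[OF assms(1)] alternating_cong[OF assms(2)] by blast+
  then show "a * \<alpha> v + b * \<beta> v = a * \<alpha> w + b * \<beta> w" by simp
next
  fix v i assume "i < k"
  then have "linear (\<lambda>u. a *\<^sub>R \<alpha> (v(i := u)) + b *\<^sub>R \<beta> (v(i := u)))"
    by (intro linear_compose_add linear_compose_scale_right alternating_linear[OF assms(1)]
        alternating_linear[OF assms(2)])
  then show "linear (\<lambda>u. a * \<alpha> (v(i := u)) + b * \<beta> (v(i := u)))" by simp
next
  fix v :: "nat \<Rightarrow> 'a" and i j assume "i < j" "j < k" "v i = v j"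
  then have "\<alpha> v = 0" "\<beta> v = 0"
    using alternating_repeat[OF assms(1), of i j] alternating_repeat[OF assms(2), of i j] by simp_all
  then show "a * \<alpha> v + b * \<beta> v = 0" by simp
qed

text \<open>
  \<open>case_nat u v\<close> is the tuple \<open>v\<close> with \<open>u\<close> put in front.
\<close>

lemma alternating_case_nat:
  assumes "alternating (Suc k) \<alpha>"
  shows "alternating k (\<lambda>v. \<alpha> (case_nat u v))"
  unfolding alternating_def
proof (intro conjI allI impI)
  fix v w :: "nat \<Rightarrow> 'a" assume "\<forall>i<k. v i = w i"
  then show "\<alpha> (case_nat u v) = \<alpha> (case_nat u w)"
    by (intro alternating_cong[OF assms]) (auto split: nat.split)
next
  fix v i assume "i < k"
  have "case_nat u (v(i := x)) = (case_nat u v)(Suc i := x)" for x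
    by (auto simp: fun_eq_iff split: nat.split)
  then show "linear (\<lambda>x. \<alpha> (case_nat u (v(i := x))))"
    using alternating_linear[OF assms, of "Suc i" "case_nat u v"] \<open>i < k\<close> by simp
next
  fix v :: "nat \<Rightarrow> 'a" and i j assume "i < j" "j < k" "v i = v j"
  then show "\<alpha> (case_nat u v) = 0"
    by (intro alternating_repeat[OF assms, of "Suc i" "Suc j"]) auto
qed

lemma alternating_linear_first:
  assumes "alternating (Suc k) \<alpha>"
  shows "linear (\<lambda>u. \<alpha> (case_nat u v))"
proof -
  have eq: "(case_nat 0 v)(0 := u) = case_nat u v" for u
    by (auto simp: fun_eq_iff split: nat.split)
  show ?thesis
    using alternating_linear[OF assms, of 0 "case_nat 0 v"] by (simp only: eq zero_less_Suc)
qed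

abbreviation drop_slot :: "nat \<Rightarrow> (nat \<Rightarrow> 'a) \<Rightarrow> nat \<Rightarrow> 'a" where
  "drop_slot i v \<equiv> \<lambda>j. if j < i then v j else v (Suc j)"

text \<open>
  \<open>u\<close> travels from the front to slot \<open>i\<close> by \<open>i\<close> transpositions of neighbours. These are the signs in the
  definition of the exterior derivative.
\<close>

lemma alternating_move_to_slot:
  assumes "alternating k \<alpha>" "i < k"
  shows "\<alpha> (case_nat u (drop_slot i v)) = (- 1) ^ i * \<alpha> (v(i := u))"
  using assms(2)
proof (induction i arbitrary: v)
  case 0
  have "case_nat u (drop_slot 0 v) = v(0 := u)"
    by (auto simp: fun_eq_iff split: nat.split)
  then have "\<alpha> (case_nat u (drop_slot 0 v)) = \<alpha> (v(0 := u))" by (rule arg_cong)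
  then show ?case by (simp only: power_0 mult_1_left)
next
  case (Suc i)
  have "case_nat u (drop_slot (Suc i) v) = case_nat u (drop_slot i (v(Suc i := v i)))"
    by (auto simp: fun_eq_iff less_Suc_eq split: nat.split)
  then have "\<alpha> (case_nat u (drop_slot (Suc i) v))
      = (- 1) ^ i * \<alpha> (v(Suc i := v i, i := u))"
    using Suc.IH[of "v(Suc i := v i)"] Suc.prems by (simp only: Suc_lessD)
  also have "\<dots> = (- 1) ^ i * - \<alpha> (v(Suc i := u, i := v i))"
    using Suc.prems by (subst alternating_swap[OF assms(1), of "Suc i" i v]) simp_all
  also have "v(Suc i := u, i := v i) = v(Suc i := u)"
    by auto
  finally show ?case by simp
qed

text \<open>
  This is the infinitesimal action of \<open>B\<close> on alternating forms. If two entries agree, the two terms in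
  which one of them is replaced differ by a transposition and cancel.
\<close>

lemma alternating_derivation:
  assumes "alternating k \<alpha>" "linear B"
  shows "alternating k (\<lambda>v. \<Sum>i<k. \<alpha> (v(i := B (v i))))"
  unfolding alternating_def
proof (intro conjI allI impI)
  fix v w :: "nat \<Rightarrow> 'a" assume "\<forall>i<k. v i = w i"
  then show "(\<Sum>i<k. \<alpha> (v(i := B (v i)))) = (\<Sum>i<k. \<alpha> (w(i := B (w i))))"
    by (intro sum.cong alternating_cong[OF assms(1)]) auto
next
  fix v i assume i: "i < k"
  have "linear (\<lambda>u. \<alpha> ((v(i := u))(j := B ((v(i := u)) j))))" if "j < k" for j
  proof (cases "i = j")
    case True
    then show ?thesis
      using linear_compose[OF assms(2) alternating_linear[OF assms(1) i]] by (simp add: o_def)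
  next
    case False
    then show ?thesis
      using alternating_linear[OF assms(1) i, of "v(j := B (v j))"] by (simp add: fun_upd_twist)
  qed
  then show "linear (\<lambda>u. \<Sum>j<k. \<alpha> ((v(i := u))(j := B ((v(i := u)) j))))"
    by (intro linear_compose_sum) auto
next
  fix v :: "nat \<Rightarrow> 'a" and i j assume ij: "i < j" "j < k" "v i = v j"
  have zero: "\<alpha> (v(p := B (v p))) = 0" if "p \<noteq> i" "p \<noteq> j" for p
    using ij that by (intro alternating_repeat[OF assms(1), of i j]) auto
  have "(\<Sum>p<k. \<alpha> (v(p := B (v p)))) = (\<Sum>p\<in>{i, j}. \<alpha> (v(p := B (v p))))"
    using ij by (intro sum.mono_neutral_right) (auto simp: zero)
  also have "\<dots> = \<alpha> (v(i := B (v i), j := v i)) + \<alpha> (v(i := v i, j := B (v i)))"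
    using ij by (simp add: fun_upd_idem fun_upd_twist)
  also have "\<dots> = 0"
    using alternating_swap[OF assms(1), of i j v "B (v i)" "v i"] ij by simp
  finally show "(\<Sum>p<k. \<alpha> (v(p := B (v p)))) = 0" .
qed

text \<open>
  If two entries agree, composing with their transposition pairs the permutations into couples of
  opposite sign whose terms are otherwise equal.
\<close>

lemma alternating_wedge:
  assumes "alternating k (\<omega> x)" "alternating l (\<eta> x)"
  shows "alternating (k + l) (wedge k l \<omega> \<eta> x)"
proof -
  define g where "g \<sigma> v = \<omega> x (\<lambda>i. v (\<sigma> i)) * \<eta> x (\<lambda>i. v (\<sigma> (k + i)))" for \<sigma> and v :: "nat \<Rightarrow> 'a"
  have wedge_eq: "wedge k l \<omega> \<eta> x v =
      (\<Sum>\<sigma> | \<sigma> permutes {..<k + l}. of_int (sign \<sigma>) * g \<sigma> v) / (fact k * fact l)" for v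
    by (simp add: wedge_def g_def mult.assoc)
  have perm_less: "\<sigma> i < k + l" if "\<sigma> permutes {..<k + l}" "i < k + l" for \<sigma> i
    using permutes_in_image[OF that(1)] that(2) by auto
  show ?thesis
    unfolding alternating_def
  proof (intro conjI allI impI)
    fix v w :: "nat \<Rightarrow> 'a" assume "\<forall>i<k + l. v i = w i"
    then have "g \<sigma> v = g \<sigma> w" if "\<sigma> permutes {..<k + l}" for \<sigma>
      unfolding g_def using perm_less[OF that]
      by (intro arg_cong2[of _ _ _ _ "(*)"] alternating_cong[OF assms(1)]
          alternating_cong[OF assms(2)]) auto
    then show "wedge k l \<omega> \<eta> x v = wedge k l \<omega> \<eta> x w"
      unfolding wedge_eq by (intro arg_cong2[of _ _ _ _ "(/)"] sum.cong refl) simp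
  next
    fix v i assume i: "i < k + l"
    have "linear (\<lambda>u. g \<sigma> (v(i := u)))" if \<sigma>: "\<sigma> permutes {..<k + l}" for \<sigma>
    proof -
      define p where "p = inv \<sigma> i"
      have p: "\<sigma> j = i \<longleftrightarrow> j = p" for j
        using permutes_inverses[OF \<sigma>] by (auto simp: p_def)
      have "p < k + l"
        using permutes_in_image[OF permutes_inv[OF \<sigma>]] i by (auto simp: p_def)
      have upd: "(\<lambda>j. (v(i := u)) (\<sigma> j)) = (\<lambda>j. v (\<sigma> j))(p := u)"
        "(\<lambda>j. (v(i := u)) (\<sigma> (k + j))) =
          (if p < k then (\<lambda>j. v (\<sigma> (k + j))) else (\<lambda>j. v (\<sigma> (k + j)))(p - k := u))" for u
        by (auto simp: p fun_eq_iff)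
      show ?thesis
      proof (cases "p < k")
        case True
        have "linear (\<lambda>u. \<eta> x (\<lambda>j. v (\<sigma> (k + j))) *\<^sub>R \<omega> x ((\<lambda>j. v (\<sigma> j))(p := u)))"
          by (intro linear_compose_scale_right alternating_linear[OF assms(1)] True)
        then show ?thesis
          unfolding g_def upd using True by (simp add: mult.commute)
      next
        case False
        have "\<omega> x ((\<lambda>j. v (\<sigma> j))(p := u)) = \<omega> x (\<lambda>j. v (\<sigma> j))" for u
          using False by (intro alternating_cong[OF assms(1)]) auto
        moreover have "linear (\<lambda>u. \<omega> x (\<lambda>j. v (\<sigma> j)) *\<^sub>R \<eta> x ((\<lambda>j. v (\<sigma> (k + j)))(p - k := u)))"
          using False \<open>p < k + l\<close>
          by (intro linear_compose_scale_right alternating_linear[OF assms(2)]) auto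
        ultimately show ?thesis
          unfolding g_def upd using False by simp
      qed
    qed
    then have "linear (\<lambda>u. (1 / (fact k * fact l)) *\<^sub>R
        (\<Sum>\<sigma> | \<sigma> permutes {..<k + l}. of_int (sign \<sigma>) *\<^sub>R g \<sigma> (v(i := u))))"
      by (intro linear_compose_scale_right linear_compose_sum ballI) blast
    then show "linear (\<lambda>u. wedge k l \<omega> \<eta> x (v(i := u)))"
      unfolding wedge_eq by simp
  next
    fix v :: "nat \<Rightarrow> 'a" and i j assume ij: "i < j" "j < k + l" "v i = v j"
    define t where "t = Transposition.transpose i j"
    have t: "t permutes {..<k + l}"
      using ij unfolding t_def by (intro permutes_swap_id) auto
    have "sign (t \<circ> \<sigma>) = - sign \<sigma>" if "\<sigma> permutes {..<k + l}" for \<sigma>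
    proof -
      have "permutation t" "permutation \<sigma>"
        using permutation_permutes t that by blast+
      then show ?thesis
        using ij by (simp add: sign_compose t_def sign_swap_id)
    qed
    moreover have "g (t \<circ> \<sigma>) v = g \<sigma> v" for \<sigma>
    proof -
      have "v (t p) = v p" for p
        using ij by (cases "p = i"; cases "p = j") (auto simp: t_def)
      then show ?thesis by (simp add: g_def)
    qed
    ultimately have "(\<Sum>\<sigma> | \<sigma> permutes {..<k + l}. of_int (sign (t \<circ> \<sigma>)) * g (t \<circ> \<sigma>) v)
        = - (\<Sum>\<sigma> | \<sigma> permutes {..<k + l}. of_int (sign \<sigma>) * g \<sigma> v)"
      unfolding sum_negf[symmetric] by (intro sum.cong refl) simp
    moreover have "(\<Sum>\<sigma> | \<sigma> permutes {..<k + l}. of_int (sign (t \<circ> \<sigma>)) * g (t \<circ> \<sigma>) v)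
        = (\<Sum>\<sigma> | \<sigma> permutes {..<k + l}. of_int (sign \<sigma>) * g \<sigma> v)"
      by (rule setum_permutations_compose_left[OF t, symmetric])
    ultimately have "(\<Sum>\<sigma> | \<sigma> permutes {..<k + l}. of_int (sign \<sigma>) * g \<sigma> v) = 0"
      by linarith
    then show "wedge k l \<omega> \<eta> x v = 0"
      unfolding wedge_eq by simp
  qed
qed

section \<open>Cartan's formula and left-invariant forms\<close>

lemma smooth_if_components_smooth:
  fixes f :: "'a::euclidean_space \<Rightarrow> 'b::euclidean_space"
  assumes "\<And>b. b \<in> Basis \<Longrightarrow> smooth (\<lambda>x. f x \<bullet> b)" "linear L"
  shows "smooth (\<lambda>x. L (f x) :: real)"
proof -
  have "L (f x) = (\<Sum>b\<in>Basis. (f x \<bullet> b) * L b)" for x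
  proof -
    have "L (f x) = L (\<Sum>b\<in>Basis. (f x \<bullet> b) *\<^sub>R b)"
      by (simp only: euclidean_representation)
    also have "\<dots> = (\<Sum>b\<in>Basis. (f x \<bullet> b) * L b)"
      using assms(2) by (simp add: linear_sum linear_scale)
    finally show ?thesis .
  qed
  then show ?thesis
    using assms(1) by (auto intro!: smooth_sum smooth_mult smooth_const)
qed

lemma form_contraction_expand:
  fixes \<alpha> :: "(nat \<Rightarrow> 'a::euclidean_space) \<Rightarrow> real"
  assumes "alternating (Suc l) \<alpha>"
  shows "\<alpha> (case_nat z w) = (\<Sum>b\<in>Basis. (z \<bullet> b) * \<alpha> (case_nat b w))"
proof -
  note lin = alternating_linear_first[OF assms, of w]
  have "\<alpha> (case_nat z w) = \<alpha> (case_nat (\<Sum>b\<in>Basis. (z \<bullet> b) *\<^sub>R b) w)"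
    by (simp only: euclidean_representation)
  also have "\<dots> = (\<Sum>b\<in>Basis. (z \<bullet> b) * \<alpha> (case_nat b w))"
    using linear_sum[OF lin, of "\<lambda>b. (z \<bullet> b) *\<^sub>R b" Basis] linear_scale[OF lin] by simp
  finally show ?thesis .
qed

text \<open>
  Cartan's formula \<open>d (\<iota>\<^sub>Z \<beta>) = L\<^sub>Z \<beta>\<close> for a closed form \<open>\<beta>\<close>, with the Lie derivative written in
  coordinates: \<open>\<beta>\<close> is differentiated along \<open>Z\<close>, and the derivative of \<open>Z\<close> acts on each argument.
\<close>

lemma cartan_formula:
  fixes \<beta> :: "'a::euclidean_space dform"
  assumes form: "is_form (Suc l) \<beta>"
    and diff: "\<And>v. (\<lambda>y. \<beta> y v) differentiable (at x)"
    and closed: "\<And>v. ext_d (Suc l) \<beta> x v = 0"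
    and Z: "(Z has_derivative Z') (at x)"
  shows "ext_d l (\<lambda>y v. \<beta> y (case_nat (Z y) v)) x v =
    frechet_derivative (\<lambda>y. \<beta> y v) (at x) (Z x) + (\<Sum>i<Suc l. \<beta> x (v(i := Z' (v i))))"
proof -
  define D where "D v = frechet_derivative (\<lambda>y. \<beta> y v) (at x)" for v
  have D: "((\<lambda>y. \<beta> y v) has_derivative D v) (at x)" for v
    using diff by (simp add: D_def frechet_derivative_works)
  have alt: "alternating (Suc l) (\<beta> y)" for y
    using form by (simp add: is_form_def)
  have D_expand: "D (case_nat z w) u = (\<Sum>b\<in>Basis. (z \<bullet> b) * D (case_nat b w) u)" for z w u
  proof -
    have "((\<lambda>y. \<Sum>b\<in>Basis. (z \<bullet> b) * \<beta> y (case_nat b w)) has_derivative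
        (\<lambda>u. \<Sum>b\<in>Basis. (z \<bullet> b) * D (case_nat b w) u)) (at x)"
      by (intro has_derivative_sum has_derivative_mult_right D)
    then have "((\<lambda>y. \<beta> y (case_nat z w)) has_derivative
        (\<lambda>u. \<Sum>b\<in>Basis. (z \<bullet> b) * D (case_nat b w) u)) (at x)"
      using form_contraction_expand[OF alt, of _ z w] by simp
    from has_derivative_unique[OF D this] show ?thesis by metis
  qed
  have contr: "frechet_derivative (\<lambda>y. \<beta> y (case_nat (Z y) w)) (at x) u =
      D (case_nat (Z x) w) u + \<beta> x (case_nat (Z' u) w)" for w u
  proof -
    have "((\<lambda>y. \<Sum>b\<in>Basis. (Z y \<bullet> b) * \<beta> y (case_nat b w)) has_derivative
        (\<lambda>u. \<Sum>b\<in>Basis. (Z x \<bullet> b) * D (case_nat b w) u + (Z' u \<bullet> b) * \<beta> x (case_nat b w))) (at x)"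
      by (intro has_derivative_sum has_derivative_mult has_derivative_inner_left Z D)
    then have "((\<lambda>y. \<beta> y (case_nat (Z y) w)) has_derivative
        (\<lambda>u. \<Sum>b\<in>Basis. (Z x \<bullet> b) * D (case_nat b w) u + (Z' u \<bullet> b) * \<beta> x (case_nat b w))) (at x)"
      using form_contraction_expand[OF alt, of _ "Z _" w] by simp
    from frechet_derivative_at[OF this, symmetric] show ?thesis
      using form_contraction_expand[OF alt, of x "Z' u" w] D_expand[of "Z x" w u]
      by (simp add: sum.distrib)
  qed
  have drop: "drop_slot 0 (case_nat z v) = v"
    "drop_slot (Suc i) (case_nat z v) = case_nat z (drop_slot i v)" for z :: 'a and i
    by (auto simp: fun_eq_iff split: nat.split)
  \<comment> \<open>Closedness, evaluated with \<open>Z x\<close> as the first argument, trades the terms in which \<open>\<beta>\<close> is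
    differentiated along the \<open>v i\<close> for the single term in which it is differentiated along \<open>Z x\<close>.\<close>
  have "0 = (\<Sum>i\<le>Suc l. (- 1) ^ i * D (drop_slot i (case_nat (Z x) v)) (case_nat (Z x) v i))"
    using closed[of "case_nat (Z x) v"] by (simp add: ext_d_def D_def)
  also have "\<dots> = D v (Z x) + (\<Sum>i\<le>l. (- 1) ^ Suc i * D (case_nat (Z x) (drop_slot i v)) (v i))"
    unfolding sum.atMost_Suc_shift drop by (simp only: power_0 mult_1_left nat.case)
  finally have first: "(\<Sum>i\<le>l. (- 1) ^ i * D (case_nat (Z x) (drop_slot i v)) (v i)) = D v (Z x)"
    by (simp add: sum_negf)
  have second: "(- 1) ^ i * \<beta> x (case_nat (Z' (v i)) (drop_slot i v)) = \<beta> x (v(i := Z' (v i)))"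
    if "i \<le> l" for i
    using that by (subst alternating_move_to_slot[OF alt])
      (simp_all only: le_imp_less_Suc mult.assoc[symmetric] power_mult_distrib[symmetric], simp)
  have "ext_d l (\<lambda>y v. \<beta> y (case_nat (Z y) v)) x v =
      (\<Sum>i\<le>l. (- 1) ^ i * D (case_nat (Z x) (drop_slot i v)) (v i)) +
      (\<Sum>i\<le>l. (- 1) ^ i * \<beta> x (case_nat (Z' (v i)) (drop_slot i v)))"
    unfolding ext_d_def contr by (simp only: distrib_left sum.distrib)
  also have "(\<Sum>i\<le>l. (- 1) ^ i * \<beta> x (case_nat (Z' (v i)) (drop_slot i v))) =
      (\<Sum>i<Suc l. \<beta> x (v(i := Z' (v i))))"
    unfolding lessThan_Suc_atMost by (intro sum.cong refl second) simp
  finally show ?thesis unfolding first by (simp only: D_def)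
qed

text \<open>
  Both groups are central extensions of a vector group by a line, with a bilinear cocycle \<open>c\<close> in
  exponential coordinates. For the Heisenberg group \<open>T\<close> is the central basis vector and \<open>c\<close> is half of
  the symplectic form; the abelian group is the degenerate case \<open>T = 0\<close>, \<open>c = 0\<close>. The \<open>T\<close>-component of a
  vector \<open>u\<close> is \<open>u \<bullet> T\<close> in both cases, and \<open>u\<close> is called horizontal if it vanishes.
\<close>

locale heisenberg_type =
  fixes mul :: "'a::euclidean_space \<Rightarrow> 'a \<Rightarrow> 'a" and c :: "'a \<Rightarrow> 'a \<Rightarrow> real" and T :: 'a
  assumes mul_eq: "mul x y = x + y + c x y *\<^sub>R T"
    and bilinear: "bounded_bilinear c"
    and anti: "c x y = - c y x"
    and c_T: "c x T = 0"
    and T_basis: "T = 0 \<or> T \<in> Basis"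
begin

abbreviation frame :: "'a \<Rightarrow> 'a \<Rightarrow> 'a" where
  "frame x u \<equiv> left_field mul u x"

lemmas c_simps = bounded_bilinear.add_left[OF bilinear] bounded_bilinear.add_right[OF bilinear]
  bounded_bilinear.diff_left[OF bilinear] bounded_bilinear.diff_right[OF bilinear]
  bounded_bilinear.scaleR_left[OF bilinear] bounded_bilinear.scaleR_right[OF bilinear]
  bounded_bilinear.zero_left[OF bilinear] bounded_bilinear.zero_right[OF bilinear]
  bounded_bilinear.minus_left[OF bilinear] bounded_bilinear.minus_right[OF bilinear]

lemma c_T_left: "c T x = 0"
  using anti[of T x] c_T by simp

lemma c_linear_left: "linear (\<lambda>x. c x u)" and c_linear_right: "linear (c x)"
  using bounded_bilinear.bounded_linear_left[OF bilinear]
    bounded_bilinear.bounded_linear_right[OF bilinear]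
  by (auto dest: bounded_linear.linear)

lemma mul_has_derivative: "(mul x has_derivative (\<lambda>v. v + c x v *\<^sub>R T)) (at y)"
proof -
  have "((\<lambda>y. x + y + c x y *\<^sub>R T) has_derivative (\<lambda>v. v + c x v *\<^sub>R T)) (at y)"
    by (auto intro!: derivative_eq_intros
        bounded_linear.has_derivative[OF bounded_bilinear.bounded_linear_right[OF bilinear]])
  then show ?thesis by (simp add: mul_eq[abs_def])
qed

lemma frechet_derivative_mul: "frechet_derivative (mul x) (at y) v = v + c x v *\<^sub>R T"
  using frechet_derivative_at[OF mul_has_derivative] by metis

lemma frame_eq: "frame x u = u + c x u *\<^sub>R T"
  by (simp add: left_field_def frechet_derivative_mul)

lemma linear_frame: "linear (frame x)"
  by (auto intro!: linearI simp: frame_eq c_simps algebra_simps)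

lemma frame_inverse: "frame x (u - c x u *\<^sub>R T) = u"
  by (simp add: frame_eq c_simps c_T)

lemma c_frame: "c y (frame x u) = c y u" "c (frame x u) y = c u y"
  by (simp_all add: frame_eq c_simps c_T c_T_left)

lemma left_invariant_frame:
  assumes "\<beta> \<in> left_invariant_forms mul j"
  shows "\<beta> x (\<lambda>i. frame x (w i)) = \<beta> 0 w"
proof -
  have "\<beta> (mul x 0) (\<lambda>i. frechet_derivative (mul x) (at 0) (w i)) = \<beta> 0 w"
    using assms by (simp add: left_invariant_forms_def)
  then show ?thesis
    by (simp add: mul_eq c_simps frechet_derivative_mul frame_eq)
qed

lemma left_invariant_alternating:
  "\<beta> \<in> left_invariant_forms mul j \<Longrightarrow> alternating j (\<beta> x)"
  by (simp add: left_invariant_forms_def is_form_def)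

text \<open>
  The coefficients of a left-invariant form are affine functions of the point, as the left-invariant
  frame differs from the coordinate frame by multiples of \<open>T\<close> only.
\<close>

lemma left_invariant_eq:
  assumes "\<beta> \<in> left_invariant_forms mul j"
  shows "\<beta> x v = \<beta> 0 v - (\<Sum>i<j. c x (v i) * \<beta> 0 (v(i := T)))"
proof -
  have "\<beta> x v = \<beta> x (\<lambda>i. frame x (v i - c x (v i) *\<^sub>R T))"
    by (simp only: frame_inverse)
  also have "\<dots> = \<beta> 0 (\<lambda>i. v i + (- c x (v i)) *\<^sub>R T)"
    by (simp add: left_invariant_frame[OF assms])
  also have "\<dots> = \<beta> 0 v - (\<Sum>i<j. c x (v i) * \<beta> 0 (v(i := T)))"
    by (subst alternating_add_multiples[OF left_invariant_alternating[OF assms]])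
      (simp add: sum_negf)
  finally show ?thesis .
qed

lemma left_invariant_has_derivative:
  assumes "\<beta> \<in> left_invariant_forms mul j"
  shows "((\<lambda>y. \<beta> y v) has_derivative (\<lambda>u. - (\<Sum>i<j. c u (v i) * \<beta> 0 (v(i := T))))) (at x)"
proof -
  have "((\<lambda>y. c y (v i)) has_derivative (\<lambda>u. c u (v i))) (at x)" for i
    by (intro bounded_linear_imp_has_derivative bounded_bilinear.bounded_linear_left[OF bilinear])
  then have "((\<lambda>y. \<beta> 0 v - (\<Sum>i<j. c y (v i) * \<beta> 0 (v(i := T)))) has_derivative
      (\<lambda>u. 0 - (\<Sum>i<j. c u (v i) * \<beta> 0 (v(i := T))))) (at x)"
    by (intro has_derivative_diff has_derivative_const has_derivative_sum has_derivative_mult_left)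
  then show ?thesis
    by (subst left_invariant_eq[OF assms, of _ v, abs_def]) simp
qed

lemma left_invariant_smooth:
  assumes "\<beta> \<in> left_invariant_forms mul j"
  shows "smooth (\<lambda>y. \<beta> y v)"
  by (subst left_invariant_eq[OF assms, of _ v, abs_def])
    (intro smooth_diff smooth_const smooth_sum smooth_mult smooth_linear c_linear_left)

text \<open>
  Minus the bracket of the vector field with components \<open>\<zeta>\<close> in the left-invariant frame with the
  left-invariant field \<open>w\<close>, again in that frame; \<open>\<zeta>'\<close> is the derivative of \<open>\<zeta>\<close>, and \<open>2 * c\<close> gives the
  structure constants of the Lie algebra.
\<close>

definition frame_bracket :: "('a \<Rightarrow> 'a) \<Rightarrow> ('a \<Rightarrow> 'a \<Rightarrow> 'a) \<Rightarrow> 'a \<Rightarrow> 'a \<Rightarrow> 'a" where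
  "frame_bracket \<zeta> \<zeta>' x w = \<zeta>' x (frame x w) + (2 * c w (\<zeta> x)) *\<^sub>R T"

definition contraction :: "'a dform \<Rightarrow> ('a \<Rightarrow> 'a) \<Rightarrow> 'a dform" where
  "contraction \<beta> \<zeta> = (\<lambda>x v. \<beta> x (case_nat (frame x (\<zeta> x)) v))"

text \<open>
  By Cartan's formula the left-hand side is the Lie derivative of \<open>\<beta>\<close>. A left-invariant form is constant
  in the left-invariant frame, so only the bracket of the field with the frame remains. The cocycle
  enters twice, once from the derivative of the field and once from that of \<open>\<beta>\<close> in coordinates, whence the
  factor \<open>2\<close> in the bracket.
\<close>

lemma ext_d_contraction_frame:
  assumes \<beta>: "\<beta> \<in> left_invariant_forms mul (Suc l)" and closed: "ext_d (Suc l) \<beta> = (\<lambda>x v. 0)"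
    and \<zeta>: "(\<zeta> has_derivative \<zeta>' x) (at x)"
  shows "ext_d l (contraction \<beta> \<zeta>) x (\<lambda>i. frame x (w i)) =
    (\<Sum>i<Suc l. \<beta> 0 (w(i := frame_bracket \<zeta> \<zeta>' x (w i))))"
proof -
  define v where "v = (\<lambda>i. frame x (w i))"
  define Z' where "Z' u = frame x (\<zeta>' x u + c u (\<zeta> x) *\<^sub>R T)" for u
  note alt = left_invariant_alternating[OF \<beta>]
  have "((\<lambda>y. \<zeta> y + c y (\<zeta> y) *\<^sub>R T) has_derivative
      (\<lambda>u. \<zeta>' x u + (c x (\<zeta>' x u) + c u (\<zeta> x)) *\<^sub>R T)) (at x)"
    by (intro has_derivative_add \<zeta> has_derivative_scaleR_left
        bounded_bilinear.FDERIV[OF bilinear] has_derivative_ident)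
  then have Z: "((\<lambda>y. frame y (\<zeta> y)) has_derivative Z') (at x)"
    by (simp add: frame_eq[abs_def] Z'_def[abs_def] c_simps c_T algebra_simps)
  have "ext_d l (contraction \<beta> \<zeta>) x v =
      frechet_derivative (\<lambda>y. \<beta> y v) (at x) (frame x (\<zeta> x)) + (\<Sum>i<Suc l. \<beta> x (v(i := Z' (v i))))"
    unfolding contraction_def
  proof (rule cartan_formula[OF _ _ _ Z])
    show "is_form (Suc l) \<beta>"
      using \<beta> by (simp add: left_invariant_forms_def)
    show "(\<lambda>y. \<beta> y v) differentiable (at x)" for v
      using left_invariant_has_derivative[OF \<beta>] by (auto simp: differentiable_def)
    show "ext_d (Suc l) \<beta> x v = 0" for v
      by (simp add: closed)
  qed
  moreover have "frechet_derivative (\<lambda>y. \<beta> y v) (at x) (frame x (\<zeta> x)) =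
      (\<Sum>i<Suc l. \<beta> 0 (w(i := c (w i) (\<zeta> x) *\<^sub>R T)))"
  proof -
    have "\<beta> 0 (v(i := T)) = \<beta> 0 (w(i := T))" if "i < Suc l" for i
    proof -
      have "v(i := T) = (\<lambda>m. if m = i then T else (w(i := T)) m + c x (w m) *\<^sub>R T)"
        by (auto simp: v_def frame_eq)
      then show ?thesis
        using alternating_absorb[OF alt that, of "w(i := T)" T] by simp
    qed
    moreover have "- c (frame x (\<zeta> x)) (v i) = c (w i) (\<zeta> x)" for i
      by (simp add: v_def c_frame anti[of "\<zeta> x"])
    ultimately have "- (c (frame x (\<zeta> x)) (v i) * \<beta> 0 (v(i := T))) =
        \<beta> 0 (w(i := c (w i) (\<zeta> x) *\<^sub>R T))" if "i < Suc l" for i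
      using that by (simp only: alternating_slot_scale[OF alt] mult_minus_left[symmetric])
    then show ?thesis
      unfolding frechet_derivative_at[OF left_invariant_has_derivative[OF \<beta>], symmetric]
        sum_negf[symmetric]
      by (intro sum.cong refl) simp
  qed
  moreover have "\<beta> x (v(i := Z' (v i))) = \<beta> 0 (w(i := \<zeta>' x (frame x (w i)) + c (w i) (\<zeta> x) *\<^sub>R T))" for i
  proof -
    have "v(i := Z' (v i)) =
        (\<lambda>m. frame x ((w(i := \<zeta>' x (frame x (w i)) + c (w i) (\<zeta> x) *\<^sub>R T)) m))"
      by (auto simp: v_def Z'_def c_frame)
    then show ?thesis by (simp only: left_invariant_frame[OF \<beta>])
  qed
  ultimately have "ext_d l (contraction \<beta> \<zeta>) x v =
      (\<Sum>i<Suc l. \<beta> 0 (w(i := c (w i) (\<zeta> x) *\<^sub>R T)) +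
        \<beta> 0 (w(i := \<zeta>' x (frame x (w i)) + c (w i) (\<zeta> x) *\<^sub>R T)))"
    by (simp only: sum.distrib)
  moreover have "\<beta> 0 (w(i := c (w i) (\<zeta> x) *\<^sub>R T)) +
      \<beta> 0 (w(i := \<zeta>' x (frame x (w i)) + c (w i) (\<zeta> x) *\<^sub>R T)) =
      \<beta> 0 (w(i := frame_bracket \<zeta> \<zeta>' x (w i)))" if "i < Suc l" for i
  proof -
    have eq: "c (w i) (\<zeta> x) *\<^sub>R T + (\<zeta>' x (frame x (w i)) + c (w i) (\<zeta> x) *\<^sub>R T) =
        frame_bracket \<zeta> \<zeta>' x (w i)"
      by (simp add: frame_bracket_def algebra_simps flip: scaleR_add_left)
    show ?thesis
      by (simp only: alternating_slot_add[OF alt that, symmetric] eq)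
  qed
  ultimately show ?thesis
    unfolding v_def[symmetric] by (elim trans) (intro sum.cong refl, simp)
qed

end

section \<open>Integrals in the left-invariant frame\<close>

lemma bij_betw_coord_frame:
  "bij_betw coord_frame {..<DIM('a)} (Basis :: 'a::euclidean_space set)"
proof -
  have "\<exists>e. bij_betw e {..<DIM('a)} (Basis :: 'a set)"
    using ex_bij_betw_nat_finite[of "Basis :: 'a set"] by (simp add: atLeast0LessThan)
  then show ?thesis
    unfolding coord_frame_def by (rule someI_ex)
qed

lemma coord_frame_Basis: "i < DIM('a) \<Longrightarrow> coord_frame i \<in> (Basis :: 'a::euclidean_space set)"
  using bij_betw_coord_frame[where 'a = 'a] by (auto simp: bij_betw_def)

context heisenberg_type
begin

lemma linear_frame_bracket:
  assumes "linear (\<zeta>' x)"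
  shows "linear (frame_bracket \<zeta> \<zeta>' x)"
  by (auto intro!: linearI simp: frame_bracket_def linear_add[OF linear_frame] linear_add[OF assms]
      linear_scale[OF linear_frame] linear_scale[OF assms] c_simps algebra_simps)

lemma is_form_ext_d_contraction:
  assumes \<beta>: "\<beta> \<in> left_invariant_forms mul (Suc l)" and closed: "ext_d (Suc l) \<beta> = (\<lambda>x v. 0)"
    and \<zeta>: "\<And>x. (\<zeta> has_derivative \<zeta>' x) (at x)"
  shows "is_form (Suc l) (ext_d l (contraction \<beta> \<zeta>))"
  unfolding is_form_def
proof
  fix x
  define \<alpha> where "\<alpha> w = (\<Sum>i<Suc l. \<beta> 0 (w(i := frame_bracket \<zeta> \<zeta>' x (w i))))" for w
  have "alternating (Suc l) \<alpha>"
    unfolding \<alpha>_def[abs_def]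
    by (intro alternating_derivation left_invariant_alternating[OF \<beta>] linear_frame_bracket
        has_derivative_linear[OF \<zeta>])
  moreover have "linear (\<lambda>u. u - c x u *\<^sub>R T)"
    by (auto intro!: linearI simp: c_simps algebra_simps)
  ultimately have "alternating (Suc l) (\<lambda>v. \<alpha> (\<lambda>i. v i - c x (v i) *\<^sub>R T))"
    by (rule alternating_comp_linear)
  moreover have "ext_d l (contraction \<beta> \<zeta>) x v = \<alpha> (\<lambda>i. v i - c x (v i) *\<^sub>R T)" for v
  proof -
    have "ext_d l (contraction \<beta> \<zeta>) x (\<lambda>i. frame x (v i - c x (v i) *\<^sub>R T)) =
        \<alpha> (\<lambda>i. v i - c x (v i) *\<^sub>R T)"
      unfolding \<alpha>_def by (rule ext_d_contraction_frame[where \<zeta>' = \<zeta>', OF \<beta> closed \<zeta>])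
    then show ?thesis by (simp only: frame_inverse)
  qed
  ultimately show "alternating (Suc l) (ext_d l (contraction \<beta> \<zeta>) x)"
    by presburger
qed

lemma smooth_c_self:
  assumes "\<And>b. b \<in> Basis \<Longrightarrow> smooth (\<lambda>x. \<zeta> x \<bullet> b)"
  shows "smooth (\<lambda>x. c x (\<zeta> x))"
proof -
  have "c x (\<zeta> x) = (\<Sum>b\<in>Basis. (\<zeta> x \<bullet> b) * c x b)" for x
  proof -
    have "c x (\<zeta> x) = c x (\<Sum>b\<in>Basis. (\<zeta> x \<bullet> b) *\<^sub>R b)"
      by (simp only: euclidean_representation)
    also have "\<dots> = (\<Sum>b\<in>Basis. (\<zeta> x \<bullet> b) * c x b)"
      by (simp add: linear_sum[OF c_linear_right] linear_scale[OF c_linear_right])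
    finally show ?thesis .
  qed
  then show ?thesis
    by (simp only:) (intro smooth_sum smooth_mult assms smooth_linear c_linear_left)
qed

lemma test_form_contraction:
  assumes \<beta>: "\<beta> \<in> left_invariant_forms mul (Suc l)"
    and smooth: "\<And>b. b \<in> Basis \<Longrightarrow> smooth (\<lambda>x. \<zeta> x \<bullet> b)"
    and K: "compact K" "\<And>x. x \<notin> K \<Longrightarrow> \<zeta> x = 0"
  shows "test_form l (contraction \<beta> \<zeta>)"
proof -
  note alt = left_invariant_alternating[OF \<beta>]
  have "is_form l (contraction \<beta> \<zeta>)"
    by (simp add: is_form_def contraction_def alternating_case_nat[OF alt])
  moreover have "smooth (\<lambda>x. contraction \<beta> \<zeta> x v)" for v
  proof -
    have "smooth (\<lambda>x. \<Sum>b\<in>Basis. (\<zeta> x \<bullet> b + c x (\<zeta> x) * (T \<bullet> b)) * \<beta> x (case_nat b v))"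
      by (intro smooth_sum smooth_mult smooth_add smooth smooth_c_self smooth_const
          left_invariant_smooth[OF \<beta>])
    then show ?thesis
      unfolding contraction_def
      by (subst form_contraction_expand[OF alt]) (simp add: frame_eq inner_add_left)
  qed
  moreover have "contraction \<beta> \<zeta> x v = 0" if "x \<notin> K" for x v
    using linear_0[OF alternating_linear_first[OF alt]] K(2)[OF that]
    by (simp add: contraction_def linear_0[OF linear_frame])
  ultimately show ?thesis
    using K(1) by (auto simp: test_form_def)
qed

text \<open>
  The left-invariant frame is obtained from the coordinate frame by a unipotent matrix: multiples of
  \<open>T\<close>, which is zero or itself a member of the frame, are added to the other members.
\<close>

lemma alternating_coord_frame:
  assumes "alternating DIM('a) \<alpha>"
  shows "\<alpha> (\<lambda>i. frame x (coord_frame i)) = \<alpha> coord_frame"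
proof -
  have "c x (coord_frame i) * \<alpha> (coord_frame(i := T)) = 0" if i: "i < DIM('a)" for i
  proof (cases "T = 0")
    case True
    then show ?thesis using linear_0[OF alternating_linear[OF assms i]] by simp
  next
    case False
    then obtain m where m: "m < DIM('a)" "coord_frame m = T"
      using T_basis bij_betw_coord_frame[where 'a = 'a] unfolding bij_betw_def by (metis imageE lessThan_iff)
    show ?thesis
    proof (cases "i = m")
      case True
      then show ?thesis using m c_T by simp
    next
      case False
      then have "\<alpha> (coord_frame(i := T)) = 0"
        using m i by (intro alternating_repeat[OF assms, of i m]) auto
      then show ?thesis by simp
    qed
  qed
  then have "(\<Sum>i<DIM('a). c x (coord_frame i) * \<alpha> (coord_frame(i := T))) = 0"
    by (intro sum.neutral) simp
  then show ?thesis
    by (simp add: frame_eq alternating_add_multiples[OF assms])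
qed

text \<open>
  The integrability hypotheses on \<open>\<omega>\<close> concern its coefficients in the left-invariant frame, whereas
  integrals are taken with respect to the coordinate frame.
\<close>

lemma wedge_coord_frame:
  assumes "is_form k \<omega>" "is_form j \<eta>" "k + j = DIM('a)"
  shows "wedge k j \<omega> \<eta> x coord_frame =
    (\<Sum>\<sigma> | \<sigma> permutes {..<k + j}. of_int (sign \<sigma>) * \<omega> x (\<lambda>i. frame x (coord_frame (\<sigma> i))) *
        \<eta> x (\<lambda>i. frame x (coord_frame (\<sigma> (k + i))))) / (fact k * fact j)"
proof -
  have "alternating DIM('a) (wedge k j \<omega> \<eta> x)"
    using alternating_wedge[of k \<omega> x j \<eta>] assms by (simp add: is_form_def)
  from alternating_coord_frame[OF this, of x] show ?thesis
    by (simp add: wedge_def)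
qed

lemma Omega_1_integrable:
  assumes "\<omega> \<in> Omega mul k s 1" "\<And>i. i < k \<Longrightarrow> b i \<in> Basis"
  shows "integrable lborel (\<lambda>x. \<omega> x (\<lambda>i. frame x (b i)))"
proof -
  have "sobolev mul s 1 (\<lambda>x. \<omega> x (\<lambda>i. frame x (b i)))"
    using assms by (simp add: Omega_def)
  then have "Lp 1 (\<lambda>x. \<omega> x (\<lambda>i. frame x (b i)))"
    by (cases s) auto
  then show ?thesis
    by (auto simp: Lp_def intro: integrable_abs_cancel)
qed

text \<open>
  Dominated convergence: the products of the integrable coefficients of \<open>\<omega>\<close> with uniform bounds for
  those of \<open>\<eta> n\<close> dominate the integrands.
\<close>

lemma tendsto_form_integral_wedge:
  assumes \<omega>: "\<omega> \<in> Omega mul k s 1" and kj: "k + j = DIM('a)"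
    and forms: "\<And>n. is_form j (\<eta> n)" "is_form j \<eta>'"
    and meas: "\<And>n w. (\<lambda>x. \<eta> n x (\<lambda>i. frame x (w i))) \<in> borel_measurable borel"
    and bound: "\<And>w. \<exists>C. \<forall>n x. \<bar>\<eta> n x (\<lambda>i. frame x (w i))\<bar> \<le> C"
    and lim: "\<And>x w. (\<lambda>n. \<eta> n x (\<lambda>i. frame x (w i))) \<longlonglongrightarrow> \<eta>' x (\<lambda>i. frame x (w i))"
  shows "(\<lambda>n. form_integral (wedge k j \<omega> (\<eta> n))) \<longlonglongrightarrow> form_integral (wedge k j \<omega> \<eta>')"
    and "integrable lborel (\<lambda>x. wedge k j \<omega> \<eta>' x coord_frame)"
proof -
  let ?e = "coord_frame :: nat \<Rightarrow> 'a"
  define W where "W = (\<lambda>\<sigma> x. of_int (sign \<sigma>) * \<omega> x (\<lambda>i. frame x (?e (\<sigma> i))))"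
  define E where "E = (\<lambda>\<sigma> \<eta> x. \<eta> x (\<lambda>i. frame x (?e (\<sigma> (k + i)))) :: real)"
  have \<omega>form: "is_form k \<omega>" using \<omega> by (simp add: Omega_def)
  have eq: "wedge k j \<omega> \<theta> x coord_frame =
      (\<Sum>\<sigma> | \<sigma> permutes {..<k + j}. W \<sigma> x * E \<sigma> \<theta> x) / (fact k * fact j)"
    if "is_form j \<theta>" for \<theta> x
    using wedge_coord_frame[OF \<omega>form that kj] by (simp add: W_def E_def)
  have W: "integrable lborel (W \<sigma>)" if "\<sigma> permutes {..<k + j}" for \<sigma>
  proof -
    have "?e (\<sigma> i) \<in> Basis" if "i < k" for i
      using coord_frame_Basis permutes_in_image[OF \<open>\<sigma> permutes _\<close>, of i] that kj by simp
    then show ?thesis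
      unfolding W_def by (intro integrable_mult_right Omega_1_integrable[OF \<omega>]) auto
  qed
  have "\<forall>\<sigma>. \<exists>C. \<forall>n x. \<bar>E \<sigma> (\<eta> n) x\<bar> \<le> C"
    using bound by (simp add: E_def)
  then obtain C where C: "\<And>\<sigma> n x. \<bar>E \<sigma> (\<eta> n) x\<bar> \<le> C \<sigma>"
    by metis
  have C0: "0 \<le> C \<sigma>" for \<sigma> using C[of \<sigma> 0 0] by linarith
  have Elim: "(\<lambda>n. E \<sigma> (\<eta> n) x) \<longlonglongrightarrow> E \<sigma> \<eta>' x" for \<sigma> x
    using lim by (simp add: E_def)
  have Emeas: "E \<sigma> (\<eta> n) \<in> borel_measurable borel" for \<sigma> n
    using meas by (simp add: E_def[abs_def])
  have Emeas': "E \<sigma> \<eta>' \<in> borel_measurable borel" for \<sigma>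
    by (rule borel_measurable_LIMSEQ_real[OF Elim Emeas])
  \<comment> \<open>The dominating function.\<close>
  define G where "G = (\<lambda>x. \<Sum>\<sigma> | \<sigma> permutes {..<k + j}. C \<sigma> * \<bar>W \<sigma> x\<bar>)"
  have G: "integrable lborel G"
    unfolding G_def
    by (intro Bochner_Integration.integrable_sum integrable_mult_right integrable_abs) (simp add: W)
  have Wmeas: "W \<sigma> \<in> borel_measurable borel" if "\<sigma> permutes {..<k + j}" for \<sigma>
    using borel_measurable_integrable[OF W[OF that]] by simp
  have sums:
    "(\<lambda>x. \<Sum>\<sigma> | \<sigma> permutes {..<k + j}. W \<sigma> x * E \<sigma> \<eta>' x) \<in> borel_measurable lborel"
    "\<And>n. (\<lambda>x. \<Sum>\<sigma> | \<sigma> permutes {..<k + j}. W \<sigma> x * E \<sigma> (\<eta> n) x) \<in> borel_measurable lborel"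
    using Wmeas Emeas Emeas' by (auto intro!: borel_measurable_sum borel_measurable_times)
  have pointwise: "AE x in lborel. (\<lambda>n. \<Sum>\<sigma> | \<sigma> permutes {..<k + j}. W \<sigma> x * E \<sigma> (\<eta> n) x)
      \<longlonglongrightarrow> (\<Sum>\<sigma> | \<sigma> permutes {..<k + j}. W \<sigma> x * E \<sigma> \<eta>' x)"
    by (intro AE_I2 tendsto_sum tendsto_mult tendsto_const Elim)
  have dom: "AE x in lborel. norm (\<Sum>\<sigma> | \<sigma> permutes {..<k + j}. W \<sigma> x * E \<sigma> (\<eta> n) x) \<le> G x" for n
  proof (intro AE_I2)
    fix x
    have "\<bar>W \<sigma> x * E \<sigma> (\<eta> n) x\<bar> \<le> C \<sigma> * \<bar>W \<sigma> x\<bar>" for \<sigma>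
      using mult_right_mono[OF C[of \<sigma> n x], of "\<bar>W \<sigma> x\<bar>"] by (simp add: abs_mult mult.commute)
    then show "norm (\<Sum>\<sigma> | \<sigma> permutes {..<k + j}. W \<sigma> x * E \<sigma> (\<eta> n) x) \<le> G x"
      unfolding G_def real_norm_def by (intro order_trans[OF sum_abs] sum_mono)
  qed
  note conv = integrable_dominated_convergence[OF sums G pointwise dom]
    integral_dominated_convergence[OF sums G pointwise dom]
  have eq_int: "form_integral (wedge k j \<omega> \<theta>) =
      (LINT x|lborel. (\<Sum>\<sigma> | \<sigma> permutes {..<k + j}. W \<sigma> x * E \<sigma> \<theta> x)) / (fact k * fact j)"
    if "is_form j \<theta>" for \<theta>
    by (simp add: form_integral_def eq[OF that])
  show "(\<lambda>n. form_integral (wedge k j \<omega> (\<eta> n))) \<longlonglongrightarrow> form_integral (wedge k j \<omega> \<eta>')"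
    unfolding eq_int[OF forms(1)] eq_int[OF forms(2)] by (intro tendsto_divide conv tendsto_const) simp
  show "integrable lborel (\<lambda>x. wedge k j \<omega> \<eta>' x coord_frame)"
    unfolding eq[OF forms(2)] by (intro integrable_divide conv)
qed

lemma integrable_wedge_left_invariant:
  assumes "\<omega> \<in> Omega mul k s 1" "k + j = DIM('a)" "\<beta> \<in> left_invariant_forms mul j"
  shows "integrable lborel (\<lambda>x. wedge k j \<omega> \<beta> x coord_frame)"
proof (rule tendsto_form_integral_wedge(2)[OF assms(1,2), of "\<lambda>n. \<beta>"])
  show "is_form j \<beta>" using assms(3) by (simp add: left_invariant_forms_def)
  then show "is_form j \<beta>" .
qed (auto simp: left_invariant_frame[OF assms(3)])

end

section \<open>Contact fields and dilations\<close>

context heisenberg_type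
begin

lemma T_inner_T: "(T \<bullet> T) *\<^sub>R T = T" "(u \<bullet> T) * (T \<bullet> T) = u \<bullet> T"
  using T_basis by auto

text \<open>
  For \<open>r \<noteq> 0\<close> this is the automorphism that multiplies horizontal vectors by \<open>r\<close> and \<open>T\<close> by \<open>r\<^sup>2\<close>.
\<close>

definition dilation :: "real \<Rightarrow> 'a \<Rightarrow> 'a" where
  "dilation r u = r *\<^sub>R u + ((r\<^sup>2 - r) * (u \<bullet> T)) *\<^sub>R T"

lemma linear_dilation: "linear (dilation r)"
  by (auto intro!: linearI simp: dilation_def inner_add_left algebra_simps)

lemma dilation_frame:
  "dilation r (frame x w) = frame (dilation r x) (dilation r w)"
  using T_basis
  by (auto simp: frame_eq dilation_def c_simps c_T c_T_left inner_add_left algebra_simps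
      power2_eq_square)
end

text \<open>
  \<open>\<zeta>\<close> gives the components, in the left-invariant frame, of a smooth vector field with compact support
  whose brackets with that frame are, at the unit and up to the factor \<open>\<kappa>\<close>, those of the generator of the
  dilations.
  The condition \<open>contact\<close> says that the flow of the field preserves the horizontal distribution. It keeps
  the fields obtained by dilation under control: without it the \<open>T\<close>-component of the bracket with a
  horizontal field would be multiplied by the ratio of the dilation.
\<close>

locale contact_cutoff = heisenberg_type +
  fixes \<zeta> :: "'a \<Rightarrow> 'a" and \<zeta>' :: "'a \<Rightarrow> 'a \<Rightarrow> 'a" and K :: "'a set" and \<kappa> :: real
  assumes smooth_components: "smooth (\<lambda>x. \<zeta> x \<bullet> b)"
    and field_derivative: "(\<zeta> has_derivative \<zeta>' x) (at x)"
    and support: "compact K" "x \<notin> K \<Longrightarrow> \<zeta> x = 0"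
    and contact: "w \<bullet> T = 0 \<Longrightarrow> frame_bracket \<zeta> \<zeta>' x w \<bullet> T = 0"
    and euler: "frame_bracket \<zeta> \<zeta>' 0 w = \<kappa> *\<^sub>R (w + (w \<bullet> T) *\<^sub>R T)"
    and \<kappa>: "\<kappa> \<noteq> 0"
begin

abbreviation bracket :: "'a \<Rightarrow> 'a \<Rightarrow> 'a" where
  "bracket \<equiv> frame_bracket \<zeta> \<zeta>'"

lemma linear_bracket: "linear (bracket x)"
  by (intro linear_frame_bracket has_derivative_linear[OF field_derivative])

lemma continuous_bracket: "continuous_on UNIV (\<lambda>x. bracket x w)"
proof -
  have deriv: "continuous_on UNIV (\<lambda>x. \<zeta>' x v)" for v
  proof -
    have "\<zeta>' x v \<bullet> b = frechet_derivative (\<lambda>x. \<zeta> x \<bullet> b) (at x) v" for x b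
      using frechet_derivative_at[OF has_derivative_inner_left[OF field_derivative]] by metis
    then have "continuous_on UNIV (\<lambda>x. \<zeta>' x v \<bullet> b)" for b
      using smooth_directional_continuous[OF smooth_components[of b], of v] by simp
    then show ?thesis
      by (intro continuous_on_componentwise[THEN iffD2]) simp
  qed
  have "bracket x w = \<zeta>' x w + c x w *\<^sub>R \<zeta>' x T + (2 * c w (\<zeta> x)) *\<^sub>R T" for x
    unfolding frame_bracket_def frame_eq
    by (simp add: linear_add[OF has_derivative_linear[OF field_derivative]]
        linear_scale[OF has_derivative_linear[OF field_derivative]])
  moreover have "continuous_on UNIV \<zeta>"
    using has_derivative_continuous[OF field_derivative]
    by (simp add: continuous_on_eq_continuous_within)
  then have "continuous_on UNIV (\<lambda>x. c w (\<zeta> x))"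
    by (rule bounded_linear.continuous_on[OF bounded_bilinear.bounded_linear_right[OF bilinear]])
  moreover have "continuous_on UNIV (\<lambda>x. c x w)"
    by (intro linear_continuous_on bounded_bilinear.bounded_linear_left[OF bilinear])
  ultimately show ?thesis
    by (simp add: continuous_intros deriv)
qed

lemma bounded_bracket: "\<exists>C. \<forall>x. norm (bracket x w) \<le> C"
proof -
  have "bounded ((\<lambda>x. bracket x w) ` K)"
    by (intro compact_imp_bounded compact_continuous_image support
        continuous_on_subset[OF continuous_bracket]) simp
  then obtain C where C: "norm (bracket x w) \<le> C" if "x \<in> K" for x
    unfolding bounded_iff by auto
  have "bracket x w = 0" if "x \<notin> K" for x
  proof -
    have "((\<lambda>x. 0) has_derivative (\<lambda>v. 0)) (at x)" by simp
    then have "(\<zeta> has_derivative (\<lambda>v. 0)) (at x)"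
      by (rule has_derivative_transform_within_open[of _ _ _ _ "- K"])
        (use that support in \<open>auto simp: compact_imp_closed open_Compl\<close>)
    from has_derivative_unique[OF field_derivative this] show ?thesis
      using support(2)[OF that] by (simp add: frame_bracket_def c_simps)
  qed
  then have "norm (bracket x w) \<le> max C 0" for x
    by (cases "x \<in> K") (auto dest: C)
  then show ?thesis by blast
qed

text \<open>
  The field is transported by the dilation of ratio \<open>n + 1\<close>, so that its bracket with the frame at a
  given point is governed by that of the original field ever closer to the unit.
\<close>

definition cutoff_field :: "nat \<Rightarrow> 'a \<Rightarrow> 'a" where
  "cutoff_field n x = dilation (Suc n) (\<zeta> (dilation (1 / Suc n) x))"

definition cutoff_field' :: "nat \<Rightarrow> 'a \<Rightarrow> 'a \<Rightarrow> 'a" where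
  "cutoff_field' n x v = dilation (Suc n) (\<zeta>' (dilation (1 / Suc n) x) (dilation (1 / Suc n) v))"

lemma cutoff_field_has_derivative: "(cutoff_field n has_derivative cutoff_field' n x) (at x)"
proof -
  have D: "(dilation r has_derivative dilation r) (at y)" for r y
    using linear_dilation by (simp add: linear_conv_bounded_linear bounded_linear_imp_has_derivative)
  show ?thesis
    unfolding cutoff_field_def[abs_def] cutoff_field'_def[abs_def]
    by (rule has_derivative_compose[OF has_derivative_compose[OF D field_derivative] D])
qed

lemma smooth_cutoff_field: "smooth (\<lambda>x. cutoff_field n x \<bullet> b)"
proof -
  have "linear (\<lambda>u. dilation (Suc n) u \<bullet> b)"
    by (auto intro!: linearI simp: linear_add[OF linear_dilation] linear_scale[OF linear_dilation]
        inner_add_left)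
  from smooth_if_components_smooth[OF smooth_components this]
  have "smooth (\<lambda>x. dilation (Suc n) (\<zeta> x) \<bullet> b)" .
  from smooth_comp_linear[OF linear_dilation this] show ?thesis
    by (simp add: cutoff_field_def)
qed

lemma dilation_inverse: "r \<noteq> 0 \<Longrightarrow> dilation r (dilation (1 / r) u) = u"
  using T_basis
  by (auto simp: dilation_def inner_add_left algebra_simps power2_eq_square divide_simps
      simp flip: scaleR_add_left)

lemma cutoff_field_support:
  assumes "x \<notin> dilation (Suc n) ` K" shows "cutoff_field n x = 0"
proof -
  have "dilation (1 / Suc n) x \<notin> K"
    using assms dilation_inverse[of "Suc n" x] by (metis imageI of_nat_neq_0)
  then show ?thesis
    by (simp add: cutoff_field_def support linear_0[OF linear_dilation])
qed

lemma compact_dilation: "compact (dilation r ` K)"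
  by (intro compact_continuous_image support linear_continuous_on)
    (simp add: linear_dilation linear_conv_bounded_linear[symmetric])

lemma cutoff_field_bracket_dilation:
  "frame_bracket (cutoff_field n) (cutoff_field' n) x w =
    dilation (Suc n) (bracket (dilation (1 / Suc n) x) (dilation (1 / Suc n) w))"
proof -
  define r where "r = real (Suc n)"
  have r: "r \<noteq> 0" by (simp add: r_def)
  have "c w (dilation r u) = r\<^sup>2 * c (dilation (1 / r) w) u" for u
    using r by (simp add: dilation_def c_simps c_T c_T_left power2_eq_square)
  moreover have "dilation r (a *\<^sub>R T) = (r\<^sup>2 * a) *\<^sub>R T" for a
    using T_basis by (auto simp: dilation_def algebra_simps)
  ultimately show ?thesis
    unfolding frame_bracket_def cutoff_field_def cutoff_field'_def r_def[symmetric] dilation_frame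
    by (simp add: linear_add[OF linear_dilation] algebra_simps)
qed

text \<open>
  Horizontal vectors are scaled by \<open>1 / r\<close> and then, as \<open>contact\<close> keeps their image horizontal, by \<open>r\<close>:
  no power of \<open>r\<close> is left. On \<open>T\<close> the first scaling is by \<open>1 / r\<^sup>2\<close> and compensates the second one, which is
  at most by \<open>r\<^sup>2\<close>. Hence the brackets stay bounded as \<open>r\<close> grows.
\<close>

lemma cutoff_field_bracket_eq:
  fixes n defines "r \<equiv> real (Suc n)"
  shows "frame_bracket (cutoff_field n) (cutoff_field' n) x w =
    bracket (dilation (1 / r) x) (w - (w \<bullet> T) *\<^sub>R T) +
    (w \<bullet> T) *\<^sub>R ((1 / r) *\<^sub>R bracket (dilation (1 / r) x) T +
      ((1 - 1 / r) * (bracket (dilation (1 / r) x) T \<bullet> T)) *\<^sub>R T)"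
proof -
  define w\<^sub>h where "w\<^sub>h = w - (w \<bullet> T) *\<^sub>R T"
  define y where "y = dilation (1 / r) x"
  have r: "r \<noteq> 0" by (simp add: r_def)
  have horizontal: "w\<^sub>h \<bullet> T = 0"
    by (simp add: w\<^sub>h_def inner_diff_left T_inner_T)
  have "dilation (1 / r) w = (1 / r) *\<^sub>R w\<^sub>h + ((w \<bullet> T) / r\<^sup>2) *\<^sub>R T"
    by (simp add: dilation_def w\<^sub>h_def scaleR_diff_right scaleR_diff_left left_diff_distrib power_divide)
  then have "bracket y (dilation (1 / r) w) = (1 / r) *\<^sub>R bracket y w\<^sub>h + ((w \<bullet> T) / r\<^sup>2) *\<^sub>R bracket y T"
    by (simp add: linear_add[OF linear_bracket] linear_scale[OF linear_bracket])
  then have "dilation r (bracket y (dilation (1 / r) w)) =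
      (1 / r) *\<^sub>R dilation r (bracket y w\<^sub>h) + ((w \<bullet> T) / r\<^sup>2) *\<^sub>R dilation r (bracket y T)"
    by (simp add: linear_add[OF linear_dilation] linear_scale[OF linear_dilation])
  also have "(1 / r) *\<^sub>R dilation r (bracket y w\<^sub>h) = bracket y w\<^sub>h"
    using r by (simp add: dilation_def contact[OF horizontal])
  also have "((w \<bullet> T) / r\<^sup>2) *\<^sub>R dilation r (bracket y T) =
      (w \<bullet> T) *\<^sub>R ((1 / r) *\<^sub>R bracket y T + ((1 - 1 / r) * (bracket y T \<bullet> T)) *\<^sub>R T)"
  proof -
    have "a / r\<^sup>2 * r = a * (1 / r)" "a / r\<^sup>2 * ((r\<^sup>2 - r) * b) = a * ((1 - 1 / r) * b)" for a b
      using r by (simp_all add: field_simps power2_eq_square)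
    then show ?thesis
      by (simp only: dilation_def scaleR_add_right scaleR_scaleR)
  qed
  finally show ?thesis
    by (simp only: cutoff_field_bracket_dilation r_def y_def w\<^sub>h_def)
qed

lemma cutoff_field_bracket_continuous:
  "continuous_on UNIV (\<lambda>x. frame_bracket (cutoff_field n) (cutoff_field' n) x w)"
proof -
  have "continuous_on UNIV (dilation r)" for r
    by (intro linear_continuous_on) (simp add: linear_dilation linear_conv_bounded_linear[symmetric])
  then have "continuous_on UNIV (\<lambda>x. bracket (dilation r x) v)" for r v
    by (intro continuous_on_compose2[OF continuous_bracket]) auto
  then show ?thesis
    unfolding cutoff_field_bracket_eq by (intro continuous_intros)
qed

lemma cutoff_field_bracket_bounded: "\<exists>C. \<forall>n x. norm (frame_bracket (cutoff_field n) (cutoff_field' n) x w) \<le> C"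
proof -
  obtain C\<^sub>1 where C\<^sub>1: "norm (bracket x (w - (w \<bullet> T) *\<^sub>R T)) \<le> C\<^sub>1" for x
    using bounded_bracket by blast
  obtain C\<^sub>2 where C\<^sub>2: "norm (bracket x T) \<le> C\<^sub>2" for x
    using bounded_bracket by blast
  have "norm T \<le> 1" using T_basis by auto
  have "norm (frame_bracket (cutoff_field n) (cutoff_field' n) x w) \<le> C\<^sub>1 + norm w * (C\<^sub>2 + C\<^sub>2)" for n x
  proof -
    define r where "r = real (Suc n)"
    define y where "y = dilation (1 / r) x"
    have r: "0 \<le> 1 / r" "1 / r \<le> 1" by (auto simp: r_def)
    have ip: "\<bar>u \<bullet> T\<bar> \<le> norm u" for u
      using Cauchy_Schwarz_ineq2[of u T] mult_left_mono[OF \<open>norm T \<le> 1\<close>, of "norm u"] by simp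
    have "norm ((1 / r) *\<^sub>R bracket y T) \<le> C\<^sub>2"
      using mult_mono[OF r(2) C\<^sub>2[of y]] r by simp
    moreover have "norm (((1 - 1 / r) * (bracket y T \<bullet> T)) *\<^sub>R T) \<le> C\<^sub>2"
    proof -
      have "\<bar>1 - 1 / r\<bar> * \<bar>bracket y T \<bullet> T\<bar> * norm T \<le> 1 * C\<^sub>2 * 1"
        using r \<open>norm T \<le> 1\<close> order_trans[OF ip C\<^sub>2] order_trans[OF norm_ge_zero C\<^sub>2]
        by (intro mult_mono) auto
      then show ?thesis by (simp add: abs_mult)
    qed
    ultimately have "norm ((1 / r) *\<^sub>R bracket y T + ((1 - 1 / r) * (bracket y T \<bullet> T)) *\<^sub>R T) \<le> C\<^sub>2 + C\<^sub>2"
      by (rule norm_triangle_le[OF add_mono])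
    then have "norm ((w \<bullet> T) *\<^sub>R ((1 / r) *\<^sub>R bracket y T + ((1 - 1 / r) * (bracket y T \<bullet> T)) *\<^sub>R T))
        \<le> norm w * (C\<^sub>2 + C\<^sub>2)"
      unfolding norm_scaleR by (intro mult_mono ip) auto
    then show ?thesis
      unfolding cutoff_field_bracket_eq r_def[symmetric] y_def[symmetric]
      by (intro norm_triangle_le add_mono C\<^sub>1)
  qed
  then show ?thesis by blast
qed

lemma cutoff_field_bracket_tendsto:
  "(\<lambda>n. frame_bracket (cutoff_field n) (cutoff_field' n) x w) \<longlonglongrightarrow> \<kappa> *\<^sub>R (w + (w \<bullet> T) *\<^sub>R T)"
proof -
  have inv: "(\<lambda>n. 1 / real (Suc n)) \<longlonglongrightarrow> 0"
    by (rule LIMSEQ_inverse_real_of_nat[unfolded inverse_eq_divide])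
  have "(\<lambda>n. dilation (1 / real (Suc n)) x) \<longlonglongrightarrow> 0 *\<^sub>R x + ((0\<^sup>2 - 0) * (x \<bullet> T)) *\<^sub>R T"
    unfolding dilation_def by (intro tendsto_intros inv)
  then have dil: "(\<lambda>n. dilation (1 / real (Suc n)) x) \<longlonglongrightarrow> 0" by simp
  have bracket: "(\<lambda>n. bracket (dilation (1 / real (Suc n)) x) v) \<longlonglongrightarrow> \<kappa> *\<^sub>R (v + (v \<bullet> T) *\<^sub>R T)" for v
    using continuous_on_tendsto_compose[OF continuous_bracket dil, of v] euler by simp
  have "(\<lambda>n. frame_bracket (cutoff_field n) (cutoff_field' n) x w) \<longlonglongrightarrow>
      \<kappa> *\<^sub>R ((w - (w \<bullet> T) *\<^sub>R T) + ((w - (w \<bullet> T) *\<^sub>R T) \<bullet> T) *\<^sub>R T) +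
      (w \<bullet> T) *\<^sub>R (0 *\<^sub>R (\<kappa> *\<^sub>R (T + (T \<bullet> T) *\<^sub>R T)) +
        ((1 - 0) * ((\<kappa> *\<^sub>R (T + (T \<bullet> T) *\<^sub>R T)) \<bullet> T)) *\<^sub>R T)"
    unfolding cutoff_field_bracket_eq by (intro tendsto_intros inv bracket)
  also have "\<kappa> *\<^sub>R ((w - (w \<bullet> T) *\<^sub>R T) + ((w - (w \<bullet> T) *\<^sub>R T) \<bullet> T) *\<^sub>R T) +
      (w \<bullet> T) *\<^sub>R (0 *\<^sub>R (\<kappa> *\<^sub>R (T + (T \<bullet> T) *\<^sub>R T)) +
        ((1 - 0) * ((\<kappa> *\<^sub>R (T + (T \<bullet> T) *\<^sub>R T)) \<bullet> T)) *\<^sub>R T) =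
      \<kappa> *\<^sub>R (w + (w \<bullet> T) *\<^sub>R T)"
    using T_basis by (auto simp: inner_diff_left inner_add_left algebra_simps)
  finally show ?thesis .
qed

end

section \<open>Vanishing of the integral\<close>

lemma ext_d_linear_pullback:
  assumes "linear M" "\<And>v. (\<lambda>y. \<omega> y v) differentiable (at (M x))"
  shows "ext_d k (\<lambda>x v. \<omega> (M x) (\<lambda>i. M (v i))) x v = ext_d k \<omega> (M x) (\<lambda>i. M (v i))"
proof -
  have M: "(M has_derivative M) (at x)"
    using assms(1) by (simp add: linear_conv_bounded_linear bounded_linear_imp_has_derivative)
  have "frechet_derivative (\<lambda>y. \<omega> (M y) w) (at x) u =
      frechet_derivative (\<lambda>y. \<omega> y w) (at (M x)) (M u)" for w u
    using frechet_derivative_at[OF has_derivative_compose[OF M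
          assms(2)[unfolded frechet_derivative_works]], of w] by metis
  then show ?thesis
    by (simp add: ext_d_def if_distrib[of M])
qed

context heisenberg_type
begin

text \<open>
  The dilation of ratio \<open>- 1\<close>. It is an involutive automorphism that separates the part of a
  left-invariant form containing \<open>T\<close> from the horizontal part: they have different parity.
\<close>

definition reflection :: "'a \<Rightarrow> 'a" where
  "reflection u = - u + (2 * (u \<bullet> T)) *\<^sub>R T"

definition reflected :: "'a dform \<Rightarrow> 'a dform" where
  "reflected \<beta> = (\<lambda>x v. \<beta> (reflection x) (\<lambda>i. reflection (v i)))"

lemma linear_reflection: "linear reflection"
  by (auto intro!: linearI simp: reflection_def inner_add_left algebra_simps)

lemma reflection_reflection: "reflection (reflection u) = u"
  using T_basis
  by (auto simp: reflection_def inner_diff_left inner_add_left algebra_simps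
      simp flip: scaleR_add_left)

lemma reflected_reflected: "reflected (reflected \<beta>) = \<beta>"
  by (simp add: reflected_def reflection_reflection)

lemma reflection_mul: "reflection (mul x y) = mul (reflection x) (reflection y)"
  and reflection_frame: "reflection (frame x w) = frame (reflection x) (reflection w)"
  using T_basis
  by (auto simp: mul_eq frame_eq reflection_def c_simps c_T c_T_left inner_add_left algebra_simps
      simp flip: scaleR_add_left)

lemma reflected_left_invariant:
  assumes "\<beta> \<in> left_invariant_forms mul j"
  shows "reflected \<beta> \<in> left_invariant_forms mul j"
proof -
  have "is_form j (reflected \<beta>)"
    unfolding is_form_def reflected_def
    by (auto intro: alternating_comp_linear left_invariant_alternating[OF assms] linear_reflection)
  moreover have "reflected \<beta> (mul g x) (\<lambda>i. frechet_derivative (mul g) (at x) (v i)) = reflected \<beta> x v"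
    for g x v
  proof -
    have "reflected \<beta> (mul g x) (\<lambda>i. frechet_derivative (mul g) (at x) (v i)) =
        \<beta> (mul (reflection g) (reflection x))
          (\<lambda>i. frechet_derivative (mul (reflection g)) (at (reflection x)) (reflection (v i)))"
      by (simp add: reflected_def reflection_mul frechet_derivative_mul reflection_frame
          flip: frame_eq)
    also have "\<dots> = reflected \<beta> x v"
      using assms by (simp add: left_invariant_forms_def reflected_def)
    finally show ?thesis .
  qed
  ultimately show ?thesis
    by (simp add: left_invariant_forms_def)
qed

lemma reflected_closed:
  assumes "\<beta> \<in> left_invariant_forms mul j" "ext_d j \<beta> = (\<lambda>x v. 0)"
  shows "ext_d j (reflected \<beta>) = (\<lambda>x v. 0)"
proof -
  have "(\<lambda>y. \<beta> y v) differentiable (at x)" for x v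
    using left_invariant_has_derivative[OF assms(1)] by (auto simp: differentiable_def)
  then have "ext_d j (reflected \<beta>) x v = ext_d j \<beta> (reflection x) (\<lambda>i. reflection (v i))" for x v
    unfolding reflected_def by (intro ext_d_linear_pullback linear_reflection)
  then show ?thesis
    by (simp add: assms(2) fun_eq_iff)
qed

lemma reflected_expand:
  assumes "alternating j (\<beta> 0)"
  shows "reflected \<beta> 0 w = (- 1) ^ j * (\<beta> 0 w - 2 * (\<Sum>i<j. (w i \<bullet> T) * \<beta> 0 (w(i := T))))"
proof -
  have "reflected \<beta> 0 w = \<beta> 0 (\<lambda>i. (- 1) *\<^sub>R (w i + (- 2 * (w i \<bullet> T)) *\<^sub>R T))"
    by (simp add: reflected_def linear_0[OF linear_reflection] reflection_def)
  also have "\<dots> = (- 1) ^ j * (\<beta> 0 w + (\<Sum>i<j. (- 2 * (w i \<bullet> T)) * \<beta> 0 (w(i := T))))"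
    by (simp only: alternating_scale[OF assms] alternating_add_multiples[OF assms])
  finally show ?thesis
    by (simp add: sum_negf sum_distrib_left mult.assoc)
qed

lemma wedge_linear_combination:
  "wedge k j \<omega> (\<lambda>x v. a * \<beta> x v + b * \<gamma> x v) x v = a * wedge k j \<omega> \<beta> x v + b * wedge k j \<omega> \<gamma> x v"
  by (simp add: wedge_def sum_distrib_left sum.distrib algebra_simps add_divide_distrib)

end

context contact_cutoff
begin

text \<open>
  The form \<open>\<omega> \<and> d (\<iota>\<^sub>Z \<beta>)\<close> has integral \<open>0\<close> for each of the cutoff fields \<open>Z\<close>. In the limit \<open>d (\<iota>\<^sub>Z \<beta>) = L\<^sub>Z \<beta>\<close>
  becomes the Lie derivative along \<open>\<kappa>\<close> times the generator of the dilations. With \<open>j = Suc l\<close>, it multiplies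
  the horizontal part of \<open>\<beta>\<close> by \<open>\<kappa> j\<close> and the part containing \<open>T\<close> by \<open>\<kappa> (j + 1)\<close>, whereas the reflection
  multiplies these parts by \<open>(- 1)\<^sup>j\<close> and \<open>- (- 1)\<^sup>j\<close>. Writing the former in terms of the latter keeps all
  forms closed and left-invariant without splitting \<open>\<beta>\<close>.
\<close>

lemma euler_relation:
  assumes \<omega>: "\<omega> \<in> Omega mul k s 1" "weak_d k \<omega> (\<lambda>x v. 0)" and kj: "k + Suc l = DIM('a)"
    and \<beta>: "\<beta> \<in> left_invariant_forms mul (Suc l)" "ext_d (Suc l) \<beta> = (\<lambda>x v. 0)"
  shows "(2 * real (Suc l) + 1) * form_integral (wedge k (Suc l) \<omega> \<beta>) =
    (- 1) ^ Suc l * form_integral (wedge k (Suc l) \<omega> (reflected \<beta>))"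
proof -
  define j where "j = Suc l"
  define \<eta> where "\<eta> n = ext_d l (contraction \<beta> (cutoff_field n))" for n
  \<comment> \<open>Chosen such that \<open>a + b * (- 1)\<^sup>j = \<kappa> * j\<close> and \<open>a - b * (- 1)\<^sup>j = \<kappa> * (j + 1)\<close>.\<close>
  define a where "a = \<kappa> * (real j + 1 / 2)"
  define b where "b = - (\<kappa> * (- 1) ^ j / 2)"
  define \<eta>' where "\<eta>' = (\<lambda>x v. a * \<beta> x v + b * reflected \<beta> x v)"
  note \<beta>' = \<beta>[folded j_def] and alt = left_invariant_alternating[OF \<beta>(1), folded j_def]
  note refl_inv = reflected_left_invariant[OF \<beta>'(1)]
  have exact: "form_integral (wedge k j \<omega> (\<eta> n)) = 0" for n
  proof -
    have "test_form l (contraction \<beta> (cutoff_field n))"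
      by (rule test_form_contraction[OF \<beta>(1) smooth_cutoff_field compact_dilation cutoff_field_support])
    moreover have "k + 1 + l = DIM('a)" using kj by simp
    ultimately have "form_integral (wedge (k + 1) l (\<lambda>x v. 0) (contraction \<beta> (cutoff_field n))) =
        (- 1) ^ (k + 1) * form_integral (wedge k (l + 1) \<omega> (\<eta> n))"
      using \<omega>(2) unfolding weak_d_def \<eta>_def by blast
    then show ?thesis
      by (simp add: form_integral_def wedge_def j_def)
  qed
  have \<eta>_frame: "\<eta> n x (\<lambda>i. frame x (w i)) =
      (\<Sum>i<j. \<beta> 0 (w(i := frame_bracket (cutoff_field n) (cutoff_field' n) x (w i))))" for n x w
    unfolding \<eta>_def j_def
    by (rule ext_d_contraction_frame[where \<zeta>' = "cutoff_field' n", OF \<beta> cutoff_field_has_derivative])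
  have slot: "bounded_linear (\<lambda>u. \<beta> 0 (w(i := u)))" if "i < j" for w i
    using alternating_linear[OF alt that] by (simp add: linear_conv_bounded_linear)
  have lim_frame: "\<eta>' x (\<lambda>i. frame x (w i)) =
      (\<Sum>i<j. \<beta> 0 (w(i := \<kappa> *\<^sub>R (w i + (w i \<bullet> T) *\<^sub>R T))))" for x w
  proof -
    have "(\<Sum>i<j. \<beta> 0 (w(i := \<kappa> *\<^sub>R (w i + (w i \<bullet> T) *\<^sub>R T)))) =
        (\<Sum>i<j. \<kappa> * (\<beta> 0 w + (w i \<bullet> T) * \<beta> 0 (w(i := T))))"
    proof (intro sum.cong refl)
      fix i assume "i \<in> {..<j}"
      then have "i < j" by simp
      then show "\<beta> 0 (w(i := \<kappa> *\<^sub>R (w i + (w i \<bullet> T) *\<^sub>R T))) =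
          \<kappa> * (\<beta> 0 w + (w i \<bullet> T) * \<beta> 0 (w(i := T)))"
        by (simp only: alternating_slot_scale[OF alt] alternating_slot_add[OF alt] fun_upd_triv)
    qed
    also have "\<dots> = \<kappa> * (real j * \<beta> 0 w + (\<Sum>i<j. (w i \<bullet> T) * \<beta> 0 (w(i := T))))"
      by (simp add: sum_distrib_left[symmetric] sum.distrib del: fun_upd_apply)
    also have "\<dots> = a * \<beta> 0 w + b * reflected \<beta> 0 w"
    proof -
      have "(- 1 :: real) ^ j * (- 1) ^ j = 1" by (simp flip: power_mult_distrib)
      then have "(- 1) ^ j * reflected \<beta> 0 w =
          \<beta> 0 w - 2 * (\<Sum>i<j. (w i \<bullet> T) * \<beta> 0 (w(i := T)))"
        by (simp only: reflected_expand[where j = j and \<beta> = \<beta>, OF alt] mult.assoc[symmetric] mult_1_left)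
      then have "b * reflected \<beta> 0 w =
          - (\<kappa> / 2) * (\<beta> 0 w - 2 * (\<Sum>i<j. (w i \<bullet> T) * \<beta> 0 (w(i := T))))"
        by (simp add: b_def)
      then show ?thesis by (simp only: a_def) (simp add: algebra_simps del: fun_upd_apply)
    qed
    finally show ?thesis
      by (simp only: \<eta>'_def left_invariant_frame[OF \<beta>'(1)] left_invariant_frame[OF refl_inv])
  qed
  have "(\<lambda>n. form_integral (wedge k j \<omega> (\<eta> n))) \<longlonglongrightarrow> form_integral (wedge k j \<omega> \<eta>')"
  proof (rule tendsto_form_integral_wedge(1)[OF \<omega>(1)])
    show "k + j = DIM('a)" using kj by (simp add: j_def)
    show "is_form j (\<eta> n)" for n
      unfolding \<eta>_def j_def by (rule is_form_ext_d_contraction[OF \<beta> cutoff_field_has_derivative])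
    show "is_form j \<eta>'"
      unfolding \<eta>'_def is_form_def
      by (intro allI alternating_linear_combination alt left_invariant_alternating[OF refl_inv])
    show "(\<lambda>x. \<eta> n x (\<lambda>i. frame x (w i))) \<in> borel_measurable borel" for n w
      unfolding \<eta>_frame
      by (intro borel_measurable_sum borel_measurable_continuous_onI
          bounded_linear.continuous_on[OF slot] cutoff_field_bracket_continuous) simp
    show "\<exists>C. \<forall>n x. \<bar>\<eta> n x (\<lambda>i. frame x (w i))\<bar> \<le> C" for w
    proof -
      have "\<exists>C. \<forall>n x. \<bar>\<beta> 0 (w(i := frame_bracket (cutoff_field n) (cutoff_field' n) x (w i)))\<bar> \<le> C" if i: "i < j" for i
      proof -
        obtain C where C: "\<And>n x. norm (frame_bracket (cutoff_field n) (cutoff_field' n) x (w i)) \<le> C"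
          using cutoff_field_bracket_bounded by blast
        obtain L where L: "0 \<le> L" "\<And>u. \<bar>\<beta> 0 (w(i := u))\<bar> \<le> norm u * L"
          using bounded_linear.nonneg_bounded[OF slot[OF i]] by (auto simp del: fun_upd_apply)
        have "\<bar>\<beta> 0 (w(i := frame_bracket (cutoff_field n) (cutoff_field' n) x (w i)))\<bar> \<le> C * L" for n x
          using order_trans[OF L(2) mult_right_mono[OF C L(1)]] .
        then show ?thesis by blast
      qed
      then obtain C where "\<And>i n x. i < j \<Longrightarrow>
          \<bar>\<beta> 0 (w(i := frame_bracket (cutoff_field n) (cutoff_field' n) x (w i)))\<bar> \<le> C i"
        by metis
      then have "\<bar>\<eta> n x (\<lambda>i. frame x (w i))\<bar> \<le> (\<Sum>i<j. C i)" for n x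
        unfolding \<eta>_frame by (intro order_trans[OF sum_abs] sum_mono) auto
      then show ?thesis by blast
    qed
    show "(\<lambda>n. \<eta> n x (\<lambda>i. frame x (w i))) \<longlonglongrightarrow> \<eta>' x (\<lambda>i. frame x (w i))" for x w
      unfolding \<eta>_frame lim_frame
      by (intro tendsto_sum bounded_linear.tendsto[OF slot] cutoff_field_bracket_tendsto) simp
  qed
  then have "form_integral (wedge k j \<omega> \<eta>') = 0"
    by (simp add: exact LIMSEQ_const_iff)
  moreover have "form_integral (wedge k j \<omega> \<eta>') =
      a * form_integral (wedge k j \<omega> \<beta>) + b * form_integral (wedge k j \<omega> (reflected \<beta>))"
  proof -
    have "k + j = DIM('a)" using kj by (simp add: j_def)
    then show ?thesis
      using integrable_wedge_left_invariant[OF \<omega>(1) _ \<beta>'(1)]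
        integrable_wedge_left_invariant[OF \<omega>(1) _ refl_inv]
      by (simp add: form_integral_def \<eta>'_def wedge_linear_combination)
  qed
  ultimately have "\<kappa> * ((2 * real j + 1) * form_integral (wedge k j \<omega> \<beta>) -
      (- 1) ^ j * form_integral (wedge k j \<omega> (reflected \<beta>))) = 0"
    by (simp add: a_def b_def algebra_simps)
  then show ?thesis
    using \<kappa> by (simp add: j_def)
qed

text \<open>
  The relation above, for \<open>\<beta>\<close> and for its reflection, forces \<open>(2 j + 1)\<^sup>2 p = p\<close> for the integral \<open>p\<close>, where
  \<open>j \<ge> 1\<close> is the degree of \<open>\<beta>\<close>.
\<close>

lemma form_integral_wedge_eq_0:
  assumes \<omega>: "\<omega> \<in> lqp_cocycles mul s 1 k" and k: "k < DIM('a)"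
    and \<beta>: "\<beta> \<in> left_invariant_forms mul (DIM('a) - k)" "ext_d (DIM('a) - k) \<beta> = (\<lambda>x v. 0)"
  shows "form_integral (wedge k (DIM('a) - k) \<omega> \<beta>) = 0"
proof -
  obtain l where l: "DIM('a) - k = Suc l"
    using k by (metis Suc_diff_Suc)
  define p where "p \<gamma> = form_integral (wedge k (Suc l) \<omega> \<gamma>)" for \<gamma>
  define e where "e = (- 1 :: real) ^ Suc l"
  have kl: "k + Suc l = DIM('a)" using l k by simp
  have \<omega>': "\<omega> \<in> Omega mul k s 1" "weak_d k \<omega> (\<lambda>x v. 0)"
    using \<omega> by (auto simp: lqp_cocycles_def)
  note \<beta>' = \<beta>[unfolded l]
  have "(2 * real (Suc l) + 1) * p \<beta> = e * p (reflected \<beta>)"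
    unfolding p_def e_def by (rule euler_relation[OF \<omega>' kl \<beta>'])
  moreover have "(2 * real (Suc l) + 1) * p (reflected \<beta>) = e * p \<beta>"
    using euler_relation[OF \<omega>' kl reflected_left_invariant[OF \<beta>'(1)] reflected_closed[OF \<beta>']]
    by (simp only: p_def e_def reflected_reflected)
  ultimately have "(2 * real (Suc l) + 1)\<^sup>2 * p \<beta> = e * e * p \<beta>"
    by (metis mult.left_commute mult.assoc power2_eq_square)
  moreover have "e * e = 1"
    unfolding e_def by (simp flip: power_mult_distrib)
  moreover have "(2 * real (Suc l) + 1)\<^sup>2 \<noteq> 1"
    by (simp add: power2_eq_1_iff)
  ultimately show ?thesis
    by (simp add: p_def l)
qed

end

section \<open>Cohomology classes\<close>

lemma weak_d_zero: "weak_d k (\<lambda>x v. 0) (\<lambda>x v. 0)"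
  by (simp add: weak_d_def form_integral_def wedge_def)

lemma is_form_zero: "is_form k (\<lambda>x v. 0)"
  by (simp add: is_form_def alternating_def linear_zero)

lemma sobolev_zero: "sobolev mul s p (\<lambda>x. 0)"
proof (induction s)
  case (Suc s)
  have "weak_left_deriv mul u (\<lambda>x. 0) (\<lambda>x. 0)" for u
    by (simp add: weak_left_deriv_def)
  with Suc show ?case by (auto simp: Lp_def)
qed (simp add: Lp_def)

text \<open>
  With the zero form as a coboundary every cocycle is related to itself, so each class has a member.
\<close>

lemma form_quotient_class:
  assumes "C \<in> form_quotient Z B" "(\<lambda>x v. 0) \<in> B"
  shows "C \<noteq> {}" "C \<subseteq> Z"
  using assms by (auto simp: form_quotient_def quotient_def)

lemma lqp_cohomology_class:
  assumes "C \<in> lqp_cohomology mul s q p k" "1 \<le> k"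
  shows "C \<noteq> {}" "C \<subseteq> lqp_cocycles mul s p k"
proof -
  have "(\<lambda>x v. 0) \<in> Omega mul j s r" for j r
    by (simp add: Omega_def is_form_zero sobolev_zero)
  then have "(\<lambda>x v. 0) \<in> lqp_coboundaries mul s q p k"
    using assms(2) weak_d_zero[of "k - 1"] unfolding lqp_coboundaries_def by blast
  from form_quotient_class[OF assms(1)[unfolded lqp_cohomology_def] this]
  show "C \<noteq> {}" "C \<subseteq> lqp_cocycles mul s p k" .
qed

lemma lie_cohomology_class:
  fixes mul :: "'a::euclidean_space \<Rightarrow> 'a \<Rightarrow> 'a"
  assumes "b \<in> lie_cohomology mul j" "1 \<le> j"
  shows "b \<noteq> {}" "b \<subseteq> {\<beta> \<in> left_invariant_forms mul j. ext_d j \<beta> = (\<lambda>x v. 0)}"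
proof -
  have "(\<lambda>x v. 0) \<in> left_invariant_forms mul (j - 1)"
    by (simp add: left_invariant_forms_def is_form_zero)
  moreover have "(\<lambda>x v. 0) = ext_d (j - 1) (\<lambda>(x :: 'a) v. 0)"
    by (simp add: ext_d_def)
  ultimately have "(\<lambda>x v. 0) \<in> {\<beta>. j \<ge> 1 \<and> (\<exists>\<gamma> \<in> left_invariant_forms mul (j - 1). \<beta> = ext_d (j - 1) \<gamma>)}"
    using assms(2) by blast
  from form_quotient_class[OF assms(1)[unfolded lie_cohomology_def] this]
  show "b \<noteq> {}" "b \<subseteq> {\<beta> \<in> left_invariant_forms mul j. ext_d j \<beta> = (\<lambda>x v. 0)}" .
qed

lemma (in contact_cutoff) averaging_pairing_eq_0:
  assumes "1 \<le> k" "k < DIM('a)"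
    and C: "C \<in> lqp_cohomology mul s q 1 k" and b: "b \<in> lie_cohomology mul (DIM('a) - k)"
  shows "averaging_pairing k C b = 0"
proof -
  have "1 \<le> DIM('a) - k" using assms(2) by simp
  note C = lqp_cohomology_class[OF C assms(1)] and b = lie_cohomology_class[OF b this]
  have "form_integral (wedge k (DIM('a) - k) \<omega> \<beta>) = 0" if "\<omega> \<in> C" "\<beta> \<in> b" for \<omega> \<beta>
    using form_integral_wedge_eq_0[OF _ assms(2)] C(2) b(2) that by blast
  then show ?thesis
    unfolding averaging_pairing_def using C(1) b(1) by (intro the_equality) auto
qed

section \<open>The two families of groups\<close>

lemma heisenberg_type_abelian: "heisenberg_type abelian_mul (\<lambda>x y. 0) 0"
  by unfold_locales (auto simp: abelian_mul_def intro: exI[of _ 0])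

lemma contact_cutoff_abelian:
  "contact_cutoff (abelian_mul :: real ^ 'n \<Rightarrow> _) (\<lambda>x y. 0) 0 (\<lambda>x. bump 0 x *\<^sub>R x)
    (\<lambda>x v. bump 0 x *\<^sub>R v + (bump 2 x * (- 2 * (x \<bullet> v))) *\<^sub>R x) (cball 0 1) (exp (- 1))"
proof -
  interpret heisenberg_type "abelian_mul :: real ^ 'n \<Rightarrow> _" "\<lambda>x y. 0" 0
    by (rule heisenberg_type_abelian)
  show ?thesis
  proof
    show "smooth (\<lambda>x :: real ^ 'n. bump 0 x *\<^sub>R x \<bullet> b)" for b
      unfolding inner_scaleR_left
      by (intro smooth_mult smooth_bump smooth_linear linearI) (simp_all add: inner_add_left)
    show "((\<lambda>x :: real ^ 'n. bump 0 x *\<^sub>R x) has_derivative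
        (\<lambda>v. bump 0 x *\<^sub>R v + (bump 2 x * (- 2 * (x \<bullet> v))) *\<^sub>R x)) (at x)" for x
      using has_derivative_scaleR[OF bump_has_derivative[of 0] has_derivative_ident]
      by (simp add: numeral_2_eq_2)
    show "bump 0 x *\<^sub>R x = 0" if "x \<notin> cball 0 1" for x :: "real ^ 'n"
      by (simp only: bump_eq_0[OF that] scaleR_zero_left)
  qed (auto simp: frame_bracket_def frame_eq bump_0)
qed

definition heis_area :: "'m::finite heis \<Rightarrow> 'm heis \<Rightarrow> real" where
  "heis_area g h = (fst g \<bullet> fst (snd h) - fst (snd g) \<bullet> fst h) / 2"

lemma heisenberg_type_heis:
  "heisenberg_type (heis_mul :: 'm::finite heis \<Rightarrow> _) heis_area (0, 0, 1)"
proof (rule heisenberg_type.intro)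
  show "bounded_bilinear (heis_area :: 'm heis \<Rightarrow> 'm heis \<Rightarrow> real)"
  proof -
    have "bilinear (heis_area :: 'm heis \<Rightarrow> 'm heis \<Rightarrow> real)"
      by (auto simp: bilinear_def heis_area_def inner_add_left inner_add_right field_simps
          intro!: linearI)
    then show ?thesis by (simp add: bilinear_conv_bounded_bilinear)
  qed
qed (auto simp: heis_mul_def heis_area_def Basis_prod_def zero_prod_def inner_commute
    field_simps split: prod.splits)

text \<open>
  A contact field is determined by its \<open>T\<close>-component \<open>f\<close>: its horizontal components are \<open>Y f\<close> along the
  fields \<open>X\<close> and \<open>- X f\<close> along the fields \<open>Y\<close>. The generator of the dilations has \<open>f = 2 t\<close>; here
  \<open>f = 2 t \<chi>\<close> with the cutoff function \<open>\<chi> = bump 0\<close>, and the horizontal components are written out. They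
  consist of a multiple of the radial vector \<open>(x, y)\<close> and a multiple of the rotated vector \<open>(y, - x)\<close>, with
  the following two coefficients.
\<close>

definition heis_rotation :: "'m::finite heis \<Rightarrow> real" where
  "heis_rotation p = - 4 * snd (snd p) * bump 2 p"

definition heis_radial :: "'m::finite heis \<Rightarrow> real" where
  "heis_radial p = bump 0 p - 2 * snd (snd p) ^ 2 * bump 2 p"

definition heis_field :: "'m::finite heis \<Rightarrow> 'm heis" where
  "heis_field p = (heis_rotation p *\<^sub>R fst (snd p) + heis_radial p *\<^sub>R fst p,
     heis_radial p *\<^sub>R fst (snd p) - heis_rotation p *\<^sub>R fst p, 2 * snd (snd p) * bump 0 p)"

definition heis_field' :: "'m::finite heis \<Rightarrow> 'm heis \<Rightarrow> 'm heis" where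
  "heis_field' p v =
     (heis_rotation p *\<^sub>R fst (snd v) + frechet_derivative heis_rotation (at p) v *\<^sub>R fst (snd p) +
        (heis_radial p *\<^sub>R fst v + frechet_derivative heis_radial (at p) v *\<^sub>R fst p),
      heis_radial p *\<^sub>R fst (snd v) + frechet_derivative heis_radial (at p) v *\<^sub>R fst (snd p) -
        (heis_rotation p *\<^sub>R fst v + frechet_derivative heis_rotation (at p) v *\<^sub>R fst p),
      2 * snd (snd p) * (bump 2 p * (- 2 * (p \<bullet> v))) + 2 * snd (snd v) * bump 0 p)"

lemma smooth_height: "smooth (\<lambda>p :: 'm::finite heis. snd (snd p))"
  by (intro smooth_linear linearI) auto

lemma smooth_heis_rotation_radial: "smooth heis_rotation" "smooth heis_radial"
  unfolding heis_rotation_def[abs_def] heis_radial_def[abs_def]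
  by (intro smooth_mult smooth_diff smooth_bump smooth_const smooth_height smooth_power)+

lemma heis_field_has_derivative: "(heis_field has_derivative heis_field' p) (at p)"
  unfolding heis_field_def[abs_def] heis_field'_def[abs_def]
  using bump_has_derivative[of 0 p, simplified]
  by (auto intro!: derivative_eq_intros smooth_has_derivative smooth_heis_rotation_radial
      simp: numeral_2_eq_2)

lemma contact_cutoff_heis:
  "contact_cutoff (heis_mul :: 'm::finite heis \<Rightarrow> _) heis_area (0, 0, 1) heis_field heis_field'
    (cball 0 1) (exp (- 1))"
proof -
  interpret heisenberg_type "heis_mul :: 'm heis \<Rightarrow> _" heis_area "(0, 0, 1)"
    by (rule heisenberg_type_heis)
  show ?thesis
  proof
    show "smooth (\<lambda>p :: 'm heis. heis_field p \<bullet> b)" for b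
    proof -
      have lin: "smooth (\<lambda>p :: 'm heis. fst p \<bullet> u)" "smooth (\<lambda>p :: 'm heis. fst (snd p) \<bullet> u)" for u
        by (intro smooth_linear linearI; simp add: inner_add_left)+
      have "heis_field p \<bullet> b =
          heis_rotation p * (fst (snd p) \<bullet> fst b) + heis_radial p * (fst p \<bullet> fst b) +
          (heis_radial p * (fst (snd p) \<bullet> fst (snd b)) - heis_rotation p * (fst p \<bullet> fst (snd b))) +
          2 * snd (snd p) * bump 0 p * snd (snd b)" for p
        by (simp add: heis_field_def inner_prod_def inner_add_left inner_diff_left)
      then show ?thesis
        by (simp only:) (intro smooth_add smooth_diff smooth_mult smooth_const smooth_bump
            smooth_height smooth_heis_rotation_radial lin)
    qed
    show "(heis_field has_derivative heis_field' p) (at p)" for p :: "'m heis"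
      by (rule heis_field_has_derivative)
    show "heis_field p = 0" if "p \<notin> cball 0 1" for p :: "'m heis"
      using bump_eq_0[OF that] by (simp add: heis_field_def heis_rotation_def heis_radial_def zero_prod_def)
    show "frame_bracket heis_field heis_field' p w \<bullet> (0, 0, 1) = 0"
      if w: "w \<bullet> (0, 0, 1) = 0" for p w :: "'m heis"
    proof -
      obtain x y t where p: "p = (x, y, t)" by (metis prod.exhaust)
      obtain u v where w: "w = (u, v, 0)"
        using w by (cases w) (auto simp: inner_prod_def)
      \<comment> \<open>The \<open>T\<close>-component of the bracket is \<open>w f + 2 * heis_area w \<zeta>\<close>, with \<open>f\<close> the last and \<open>\<zeta>\<close> all
        components of the field; the horizontal ones were chosen to cancel \<open>w f\<close>.\<close>
      show ?thesis
        by (simp add: frame_bracket_def frame_eq heis_area_def heis_field_def heis_field'_def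
            heis_rotation_def heis_radial_def p w inner_add_left inner_add_right inner_diff_left inner_diff_right
            inner_commute power2_eq_square algebra_simps add_divide_distrib diff_divide_distrib)
    qed
    show "frame_bracket heis_field heis_field' 0 w =
        exp (- 1) *\<^sub>R (w + (w \<bullet> (0, 0, 1)) *\<^sub>R (0, 0, 1))" for w :: "'m heis"
      by (cases w) (simp add: frame_bracket_def frame_eq heis_area_def heis_field_def heis_field'_def
          heis_rotation_def heis_radial_def bump_0 zero_prod_def[symmetric] algebra_simps)
  qed auto
qed

theorem theorem1p2:
  shows
    "(\<exists>s0. \<forall>s\<ge>s0. \<forall>k q.
        1 \<le> k \<longrightarrow> k < CARD('n::finite) \<longrightarrow> 1 \<le> q \<longrightarrow> q \<le> abelian_exponent CARD('n) k \<longrightarrow>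
        (\<forall>c \<in> lqp_cohomology (abelian_mul :: real ^ 'n \<Rightarrow> real ^ 'n \<Rightarrow> real ^ 'n) s q 1 k.
         \<forall>b \<in> lie_cohomology (abelian_mul :: real ^ 'n \<Rightarrow> real ^ 'n \<Rightarrow> real ^ 'n) (CARD('n) - k).
           averaging_pairing k c b = 0)) \<and>
     (\<exists>s0. \<forall>s\<ge>s0. \<forall>k q.
        1 \<le> k \<longrightarrow> k < 2 * CARD('m::finite) + 1 \<longrightarrow> 1 \<le> q \<longrightarrow> q \<le> heis_exponent CARD('m) k \<longrightarrow>
        (\<forall>c \<in> lqp_cohomology (heis_mul :: 'm heis \<Rightarrow> 'm heis \<Rightarrow> 'm heis) s q 1 k.
         \<forall>b \<in> lie_cohomology (heis_mul :: 'm heis \<Rightarrow> 'm heis \<Rightarrow> 'm heis) (2 * CARD('m) + 1 - k).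
           averaging_pairing k c b = 0))"
proof -
  have dim: "DIM(real ^ 'n) = CARD('n)" "DIM('m heis) = 2 * CARD('m) + 1" by simp_all
  show ?thesis
    using contact_cutoff.averaging_pairing_eq_0[OF contact_cutoff_abelian[where 'n = 'n], unfolded dim]
      contact_cutoff.averaging_pairing_eq_0[OF contact_cutoff_heis[where 'm = 'm], unfolded dim]
    by blast
qed

end
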